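(* Let $n\ge 5$ and $2\le k<n/2$ be integers, and let $P$ be a Poncelet $n$-gon. Then $I(D_k(P))=D_k(I(P))$; that is, the operations $I$ and $D_k$ on Poncelet polygons commute.
   Context: The setting is the plane (regarded as contained in the real projective plane, so that any two distinct lines meet in a point); conics are non-degenerate. An $n$-gon is a cyclically ordered $n$-tuple of distinct points $V_1,\dots,V_n$ (its vertices), with indices understood mod $n$; its sides are the lines $V_iV_{i+1}$. Two $n$-gons are regarded as equal if they have the same vertices in the same cyclic order (that is, up to a cyclic shift of the labels). A Poncelet $n$-gon is an $n$-gon that is inscribed in a conic (all of its vertices lie on that conic) and circumscribed about a conic (all of the lines containing its sides are tangent to that conic, called the inscribed conic). Operation $I$: for an $n$-gon $P$ ($n\ge 5$) circumscribed about a conic, $I(P)$ is the $n$-gon whose vertices are the points of tangency of the consecutive sides of $P$ with the inscribed conic, i.e. the $i$-th vertex of $I(P)$ is the tangency point of the line $V_iV_{i+1}$ with the inscribed conic. Operation $D_k$, for $2\le k<n/2$: for an $n$-gon $P$ with vertices $V_1,\dots,V_n$, let $d_i=V_iV_{i+k}$ be the line connecting the $i$-th vertex with the $(i+k)$-th vertex (a $k$-diagonal), $i=1,\dots,n$, indices mod $n$. Then $D_k(P)$ is the $n$-gon formed by the consecutive intersection points of these diagonals, i.e. with vertices $d_i\cap d_{i+1}$, $i=1,\dots,n$, in this cyclic order. The asserted equality includes that both sides are defined, in particular that $D_k(P)$ is circumscribed about a conic, so that $I(D_k(P))$ makes sense. *)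

theory Defs
  imports "HOL-Analysis.Analysis"
begin

text \<open>The real projective plane: nonzero vectors of \<open>\<real>\<^sup>3\<close> up to scaling.\<close>

definition proportional :: "real^3 \<Rightarrow> real^3 \<Rightarrow> bool" where
  "proportional x y \<longleftrightarrow> x \<noteq> 0 \<and> y \<noteq> 0 \<and> (\<exists>c. y = c *\<^sub>R x)"

lemma proportional_sym: "proportional x y \<Longrightarrow> proportional y x"
  unfolding proportional_def
  by (metis pth_4(1) scaleR_scaleR scaleR_one left_inverse)

lemma proportional_trans: "proportional x y \<Longrightarrow> proportional y z \<Longrightarrow> proportional x z"
  unfolding proportional_def by (metis scaleR_scaleR)

lemma part_equivp_proportional: "part_equivp proportional"
proof (rule part_equivpI)
  have "proportional (axis 1 1) (axis 1 1)"
    unfolding proportional_def by (metis axis_eq_0_iff one_neq_zero scaleR_one)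
  then show "\<exists>x. proportional x x" ..
  show "symp proportional" by (rule sympI) (rule proportional_sym)
  show "transp proportional" by (rule transpI) (rule proportional_trans)
qed

quotient_type ppoint = "real^3" / partial: proportional
  by (rule part_equivp_proportional)

lift_definition incident :: "ppoint \<Rightarrow> real^3 \<Rightarrow> bool" is "\<lambda>x a. a \<bullet> x = 0"
  by (auto simp: proportional_def)

lift_definition quadric_zero :: "real^3^3 \<Rightarrow> ppoint \<Rightarrow> bool" is "\<lambda>A x. x \<bullet> (A *v x) = 0"
  by (auto simp: proportional_def matrix_vector_mult_scaleR)

definition plines :: "ppoint set set" where
  "plines = {L. \<exists>a. a \<noteq> 0 \<and> L = {X. incident X a}}"

text \<open>A conic is non-degenerate and has real points; identifying it with its set of real
  points loses nothing, since these determine the matrix up to a scalar.\<close>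

definition conics :: "ppoint set set" where
  "conics = {C. C \<noteq> {} \<and>
     (\<exists>A. transpose A = A \<and> det A \<noteq> 0 \<and> C = {X. quadric_zero A X})}"

definition join :: "ppoint \<Rightarrow> ppoint \<Rightarrow> ppoint set" where
  "join X Y = (THE L. L \<in> plines \<and> X \<in> L \<and> Y \<in> L)"

definition meet :: "ppoint set \<Rightarrow> ppoint set \<Rightarrow> ppoint" where
  "meet L M = (THE X. X \<in> L \<and> X \<in> M)"

text \<open>In the projective plane a line is tangent to a non-degenerate conic iff it has exactly
  one point in common with it: a binary quadratic form with exactly one real projective zero
  has it as a double zero.\<close>

definition tangent :: "ppoint set \<Rightarrow> ppoint set \<Rightarrow> bool" where
  "tangent L C \<longleftrightarrow> L \<in> plines \<and> C \<in> conics \<and> (\<exists>!X. X \<in> L \<and> X \<in> C)"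

definition tangency_point :: "ppoint set \<Rightarrow> ppoint set \<Rightarrow> ppoint" where
  "tangency_point L C = (THE X. X \<in> L \<and> X \<in> C)"

text \<open>A labelled \<open>n\<close>-gon is the list \<open>V\<^sub>0, \<dots>, V\<^sub>n\<^sub>-\<^sub>1\<close> of its vertices; as polygons, two lists are
  regarded as equal if they differ by a rotation.\<close>

definition is_ngon :: "nat \<Rightarrow> ppoint list \<Rightarrow> bool" where
  "is_ngon n P \<longleftrightarrow> length P = n \<and> distinct P"

definition same_polygon :: "ppoint list \<Rightarrow> ppoint list \<Rightarrow> bool" where
  "same_polygon P Q \<longleftrightarrow> (\<exists>m. Q = rotate m P)"

definition vertex :: "ppoint list \<Rightarrow> nat \<Rightarrow> ppoint" where
  "vertex P i = P ! (i mod length P)"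

definition side :: "ppoint list \<Rightarrow> nat \<Rightarrow> ppoint set" where
  "side P i = join (vertex P i) (vertex P (i + 1))"

definition diagonal :: "nat \<Rightarrow> ppoint list \<Rightarrow> nat \<Rightarrow> ppoint set" where
  "diagonal k P i = join (vertex P i) (vertex P (i + k))"

definition inscribed_in :: "ppoint list \<Rightarrow> ppoint set \<Rightarrow> bool" where
  "inscribed_in P C \<longleftrightarrow> C \<in> conics \<and> set P \<subseteq> C"

definition circumscribed_about :: "ppoint list \<Rightarrow> ppoint set \<Rightarrow> bool" where
  "circumscribed_about P C \<longleftrightarrow> C \<in> conics \<and> (\<forall>i<length P. tangent (side P i) C)"

definition poncelet_ngon :: "nat \<Rightarrow> ppoint list \<Rightarrow> bool" where
  "poncelet_ngon n P \<longleftrightarrow> is_ngon n P \<and> (\<exists>C. inscribed_in P C) \<and> (\<exists>C. circumscribed_about P C)"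

definition inscribed_conic :: "ppoint list \<Rightarrow> ppoint set" where
  "inscribed_conic P = (THE C. circumscribed_about P C)"

definition op_I :: "ppoint list \<Rightarrow> ppoint list" where
  "op_I P = map (\<lambda>i. tangency_point (side P i) (inscribed_conic P)) [0..<length P]"

definition op_D :: "nat \<Rightarrow> ppoint list \<Rightarrow> ppoint list" where
  "op_D k P = map (\<lambda>i. meet (diagonal k P i) (diagonal k P (i + 1))) [0..<length P]"

text \<open>The two operations are partial. The following predicates say that all lines, points and
  conics in their definitions exist and are unique, and that the result is again an
  \<open>n\<close>-gon, i.e. has distinct vertices.\<close>

definition I_defined :: "nat \<Rightarrow> ppoint list \<Rightarrow> bool" where
  "I_defined n P \<longleftrightarrow> is_ngon n P \<and> (\<exists>!C. circumscribed_about P C) \<and> is_ngon n (op_I P)"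

definition D_defined :: "nat \<Rightarrow> nat \<Rightarrow> ppoint list \<Rightarrow> bool" where
  "D_defined n k P \<longleftrightarrow> is_ngon n P \<and>
     (\<forall>i<n. vertex P i \<noteq> vertex P (i + k) \<and> diagonal k P i \<noteq> diagonal k P (i + 1)) \<and>
     is_ngon n (op_D k P)"

end

theory Submission
  imports Defs "HOL-Number_Theory.Cong"
begin

text \<open>
  Lift the vertices of \<open>P\<close> to vectors \<open>v\<^sub>i\<close> and the tangency points to vectors \<open>t\<^sub>i\<close>, and let \<open>M\<close> and
  \<open>A\<close> be the forms of the circumscribed and of the inscribed conic. The \<open>i\<close>-th vertex of
  \<open>D\<^sub>k(I(P))\<close> is the intersection \<open>x\<^sub>i\<close> of \<open>t\<^sub>it\<^sub>i\<^sub>+\<^sub>k\<close> with \<open>t\<^sub>i\<^sub>+\<^sub>1t\<^sub>i\<^sub>+\<^sub>1\<^sub>+\<^sub>k\<close>. Polarity with respect to the inscribed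
  conic puts \<open>x\<^sub>i\<close> on the diagonal \<open>d\<^sub>i\<^sub>+\<^sub>1 = v\<^sub>i\<^sub>+\<^sub>1v\<^sub>i\<^sub>+\<^sub>1\<^sub>+\<^sub>k\<close>. A computation with the quadrangle
  \<open>v\<^sub>i\<^sub>+\<^sub>1, v\<^sub>i\<^sub>+\<^sub>2, v\<^sub>i\<^sub>+\<^sub>1\<^sub>+\<^sub>k, v\<^sub>i\<^sub>+\<^sub>2\<^sub>+\<^sub>k\<close> shows that the member \<open>A(x\<^sub>i)M - M(x\<^sub>i)A\<close> of the pencil of the two
  conics through \<open>x\<^sub>i\<close> also passes through \<open>x\<^sub>i\<^sub>+\<^sub>1\<close> and is tangent to \<open>d\<^sub>i\<^sub>+\<^sub>1\<close> at \<open>x\<^sub>i\<close>. Hence a single conic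
  \<open>F\<close> is tangent to every \<open>d\<^sub>i\<^sub>+\<^sub>1\<close> at \<open>x\<^sub>i\<close>. It is non-degenerate: otherwise all \<open>k\<close>-diagonals would be
  concurrent, and \<open>v\<^sub>j\<close>, \<open>v\<^sub>j\<^sub>+\<^sub>k\<close>, \<open>v\<^sub>j\<^sub>+\<^sub>2\<^sub>k\<close> would be three collinear points of a conic. Since \<open>d\<^sub>i\<^sub>+\<^sub>1\<close> is the
  \<open>i\<close>-th side of \<open>D\<^sub>k(P)\<close>, the point \<open>x\<^sub>i\<close> is also the \<open>i\<close>-th vertex of \<open>I(D\<^sub>k(P))\<close>.
\<close>

unbundle cross3_syntax

subsection \<open>Vectors and quadratic forms in three dimensions\<close>

text \<open>Cramer's rule with the determinant cleared, so that it is a polynomial identity valid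
  for dependent vectors too.\<close>

lemma cross3_cramer:
  "((x \<times> w) \<bullet> z) *\<^sub>R u + ((u \<times> x) \<bullet> z) *\<^sub>R w + ((u \<times> w) \<bullet> x) *\<^sub>R z = ((u \<times> w) \<bullet> z) *\<^sub>R x"
  by (simp add: vec_eq_iff forall_3 inner_vec_def sum_3 cross_components) algebra

lemma parallel_if_cross3_zero:
  assumes "u \<noteq> 0" "u \<times> x = 0"
  obtains c where "x = c *\<^sub>R u"
proof -
  have "(u \<bullet> x) *\<^sub>R u - (u \<bullet> u) *\<^sub>R x = 0"
    using Lagrange[of u u x] assms(2) by simp
  then have "x = inverse (u \<bullet> u) *\<^sub>R ((u \<bullet> x) *\<^sub>R u)"
    using assms(1) by (metis eq_iff_diff_eq_0 inner_eq_zero_iff left_inverse scaleR_one scaleR_scaleR)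
  then show thesis using that by simp
qed

lemma cross3_zero_trans:
  assumes "y \<noteq> 0" "x \<times> y = 0" "y \<times> z = 0"
  shows "x \<times> z = 0"
proof -
  have "y \<times> x = 0"
    using assms(2) cross_skew[of y x] by simp
  then obtain a b where "x = a *\<^sub>R y" "z = b *\<^sub>R y"
    using assms parallel_if_cross3_zero by metis
  then show ?thesis by (simp add: cross_mult_left cross_mult_right)
qed

lemma parallel_cross3_if_orthogonal:
  assumes "u \<times> w \<noteq> 0" "x \<bullet> u = 0" "x \<bullet> w = 0"
  obtains c where "x = c *\<^sub>R (u \<times> w)"
proof (rule parallel_if_cross3_zero[OF assms(1)])
  have "x \<times> (u \<times> w) = 0"
    using assms by (simp add: Lagrange)
  then show "(u \<times> w) \<times> x = 0"
    by (subst cross_skew) simp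
qed

lemma cross3_zero_if_orthogonal_both:
  assumes "u \<times> w \<noteq> 0" "x \<bullet> u = 0" "x \<bullet> w = 0" "y \<bullet> u = 0" "y \<bullet> w = 0"
  shows "x \<times> y = 0"
proof -
  obtain c d where "x = c *\<^sub>R (u \<times> w)" "y = d *\<^sub>R (u \<times> w)"
    using assms parallel_cross3_if_orthogonal by metis
  then show ?thesis by (simp add: cross_mult_left cross_mult_right)
qed

lemma coplanar_if_orthogonal:
  assumes "n \<noteq> 0" "n \<bullet> u = 0" "n \<bullet> w = 0" "n \<bullet> x = 0"
  shows "(u \<times> w) \<bullet> x = 0"
proof (cases "u \<times> w = 0")
  case False
  then obtain c where "n = c *\<^sub>R (u \<times> w)"
    using assms parallel_cross3_if_orthogonal by metis
  then show ?thesis using assms by auto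
qed simp

lemma span_two_if_coplanar:
  assumes "u \<times> w \<noteq> 0" "(u \<times> w) \<bullet> x = 0"
  obtains p q where "x = p *\<^sub>R u + q *\<^sub>R w"
proof -
  let ?n = "u \<times> w"
  \<comment> \<open>With the normal \<open>?n\<close> as third vector, the determinant becomes
    \<open>?n \<bullet> ?n\<close> and the third coefficient vanishes.\<close>
  have "((x \<times> w) \<bullet> ?n) *\<^sub>R u + ((u \<times> x) \<bullet> ?n) *\<^sub>R w = (?n \<bullet> ?n) *\<^sub>R x"
    using cross3_cramer[of x w ?n u] assms(2) by simp
  moreover have "?n \<bullet> ?n \<noteq> 0"
    using assms(1) by simp
  ultimately have "x = inverse (?n \<bullet> ?n) *\<^sub>R (((x \<times> w) \<bullet> ?n) *\<^sub>R u + ((u \<times> x) \<bullet> ?n) *\<^sub>R w)"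
    by (metis left_inverse scaleR_one scaleR_scaleR)
  then show thesis using that by (simp add: scaleR_add_right)
qed

section \<open>Conjugacy with respect to a conic\<close>

text \<open>For symmetric \<open>A\<close>, \<open>bf A x y = 0\<close> says that the points
  \<open>x\<close> and \<open>y\<close> are conjugate; if \<open>A\<close> is also invertible,
  \<open>A *v y\<close> is the polar line of \<open>y\<close>.\<close>

definition bf :: "real^3^3 \<Rightarrow> real^3 \<Rightarrow> real^3 \<Rightarrow> real" where
  "bf A x y = x \<bullet> (A *v y)"

lemma bf_bilinear:
  "bf A (x + y) z = bf A x z + bf A y z"
  "bf A x (y + z) = bf A x y + bf A x z"
  "bf A (x - y) z = bf A x z - bf A y z"
  "bf A x (y - z) = bf A x y - bf A x z"
  "bf A (c *\<^sub>R x) y = c * bf A x y"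
  "bf A x (c *\<^sub>R y) = c * bf A x y"
  "bf A 0 y = 0"
  "bf A x 0 = 0"
  by (simp_all add: bf_def inner_simps matrix_vector_right_distrib
      matrix_vector_mult_diff_distrib matrix_vector_mult_scaleR)

lemma bf_commute:
  assumes "transpose A = A"
  shows "bf A x y = bf A y x"
  by (metis assms bf_def dot_lmul_matrix inner_commute vector_transpose_matrix)

lemma matrix_vector_mult_eq_0_iff:
  fixes A :: "real^'n^'n"
  assumes "det A \<noteq> 0"
  shows "A *v x = 0 \<longleftrightarrow> x = 0"
  using assms by (metis invertible_det_nz inj_matrix_vector_mult injD matrix_vector_mult_0_right)

text \<open>Each of two conjugate points of the conic lies on both polars, so the polars are the
  same line; as \<open>A\<close> is injective, the points coincide.\<close>

lemma null_vectors_not_conjugate: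
  assumes "transpose A = A" "det A \<noteq> 0"
    and "x \<times> y \<noteq> 0" "bf A x x = 0" "bf A y y = 0"
  shows "bf A x y \<noteq> 0"
proof
  assume 0: "bf A x y = 0"
  have "bf A y x = 0" using 0 bf_commute[OF assms(1)] by simp
  have "(A *v x) \<times> (A *v y) = 0"
    by (rule cross3_zero_if_orthogonal_both[OF assms(3)])
      (use assms 0 \<open>bf A y x = 0\<close> in \<open>auto simp: bf_def inner_commute\<close>)
  moreover have x0: "x \<noteq> 0"
    using assms(3) by auto
  ultimately obtain c where "A *v y = c *\<^sub>R (A *v x)"
    using matrix_vector_mult_eq_0_iff[OF assms(2)] parallel_if_cross3_zero by metis
  then have "A *v (y - c *\<^sub>R x) = 0"
    by (simp add: matrix_vector_mult_diff_distrib matrix_vector_mult_scaleR)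
  then have "y = c *\<^sub>R x"
    using matrix_vector_mult_eq_0_iff[OF assms(2)] by simp
  then show False
    using assms(3) by (simp add: cross_mult_right)
qed

text \<open>A line meets the conic in at most two points: on the line spanned by \<open>x\<close>
  and \<open>y\<close> the form reduces to \<open>2 * p * q * bf A x y\<close>.\<close>

lemma null_vectors_independent:
  assumes "transpose A = A" "det A \<noteq> 0"
    and "bf A x x = 0" "bf A y y = 0" "bf A z z = 0"
    and "x \<times> y \<noteq> 0" "x \<times> z \<noteq> 0" "y \<times> z \<noteq> 0"
  shows "(x \<times> y) \<bullet> z \<noteq> 0"
proof
  assume "(x \<times> y) \<bullet> z = 0"
  then obtain p q where z: "z = p *\<^sub>R x + q *\<^sub>R y"
    using assms(6) span_two_if_coplanar by metis
  have "2 * p * q * bf A x y = 0"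
    using assms(3-5) bf_commute[OF assms(1), of x y] unfolding z by (simp add: bf_bilinear)
  then have "p = 0 \<or> q = 0"
    using null_vectors_not_conjugate[OF assms(1,2,6,3,4)] by simp
  then show False
    using assms(7,8) by (auto simp: z cross_mult_right)
qed

text \<open>The point \<open>z\<close> constructed in the proof is the intersection of \<open>t1t2\<close> and \<open>s1s2\<close>; its polar line contains
  \<open>v\<close>, \<open>w\<close> and \<open>x\<close>.\<close>

lemma harmonic_point:
  assumes sym: "transpose A = A" and det: "det A \<noteq> 0"
    and null: "bf A t1 t1 = 0" "bf A t2 t2 = 0" "bf A s1 s1 = 0" "bf A s2 s2 = 0"
    and indep: "t1 \<times> t2 \<noteq> 0" "s1 \<times> s2 \<noteq> 0" "t1 \<times> s1 \<noteq> 0" "t2 \<times> s2 \<noteq> 0"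
    and polar: "bf A v t1 = 0" "bf A v t2 = 0" "bf A w s1 = 0" "bf A w s2 = 0"
    and x: "x \<noteq> 0" "(t1 \<times> s1) \<bullet> x = 0" "(t2 \<times> s2) \<bullet> x = 0"
  shows "(v \<times> w) \<bullet> x = 0"
proof -
  obtain a b where x1: "x = a *\<^sub>R t1 + b *\<^sub>R s1"
    using indep(3) x(2) span_two_if_coplanar by metis
  obtain c d where x2: "x = c *\<^sub>R t2 + d *\<^sub>R s2"
    using indep(4) x(3) span_two_if_coplanar by metis
  define z where "z = a *\<^sub>R t1 - c *\<^sub>R t2"
  have z2: "z = d *\<^sub>R s2 - b *\<^sub>R s1"
    using x1 x2 unfolding z_def by (simp add: algebra_simps)
  have "z \<noteq> 0"
  proof
    assume "z = 0"
    then have "a *\<^sub>R t1 = c *\<^sub>R t2" "b *\<^sub>R s1 = d *\<^sub>R s2"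
      using z2 by (auto simp: z_def)
    then have "(a *\<^sub>R t1) \<times> t2 = 0" "(b *\<^sub>R s1) \<times> s2 = 0"
      by (simp_all add: cross_mult_left)
    then have "a = 0" "b = 0"
      using indep by (simp_all add: cross_mult_left)
    then show False using x1 x(1) by simp
  qed
  then have "A *v z \<noteq> 0"
    using matrix_vector_mult_eq_0_iff[OF det] by simp
  moreover have "bf A v z = 0"
    using polar by (simp add: z_def bf_bilinear)
  moreover have "bf A w z = 0"
    using polar by (simp add: z2 bf_bilinear)
  moreover have "bf A x z = 0"
  proof -
    have "x - a *\<^sub>R t1 = b *\<^sub>R s1"
      by (simp add: x1)
    moreover have "x - c *\<^sub>R t2 = d *\<^sub>R s2"
      by (simp add: x2)
    ultimately have "bf A (x - a *\<^sub>R t1) (x - a *\<^sub>R t1) = 0" "bf A (x - c *\<^sub>R t2) (x - c *\<^sub>R t2) = 0"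
      using null by (simp_all only: bf_bilinear(5,6) mult_zero_right)
    then have "bf A x x = 2 * a * bf A x t1" "bf A x x = 2 * c * bf A x t2"
      using null bf_commute[OF sym, of t1 x] bf_commute[OF sym, of t2 x]
      by (simp_all add: bf_bilinear)
    then show ?thesis
      by (simp add: z_def bf_bilinear)
  qed
  ultimately show ?thesis
    by (intro coplanar_if_orthogonal[of "A *v z"]) (simp_all add: bf_def inner_commute)
qed

text \<open>The vectors of a quadrangle can be scaled so that \<open>v + v' = w + w'\<close>. Then \<open>x\<close> and \<open>x'\<close> are the
  intersections of the line \<open>ts\<close> with \<open>vw\<close> and \<open>v'w'\<close>, and the displayed equations concern the member of
  the pencil that passes through \<open>x\<close>.\<close>

lemma pencil_step_normalized:
  fixes a b c d :: real
  assumes sym: "transpose A = A" "transpose M = M"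
    and null: "bf M v v = 0" "bf M v' v' = 0" "bf M w w = 0" "bf M w' w' = 0"
    and rel: "v + v' = w + w'"
    and t: "t = a *\<^sub>R v + b *\<^sub>R v'" and s: "s = c *\<^sub>R w + d *\<^sub>R w'"
    and tangent: "bf A t t = 0" "bf A s s = 0" "bf A t v = 0" "bf A t v' = 0" "bf A s w = 0" "bf A s w' = 0"
    and nonzero: "bf A t s \<noteq> 0" "bf M v w \<noteq> 0" "bf M v v' \<noteq> 0" "b \<noteq> 0" "d \<noteq> 0"
    and x: "x = d *\<^sub>R t - b *\<^sub>R s" and x': "x' = c *\<^sub>R t - a *\<^sub>R s"
  shows "bf A x x \<noteq> 0" "bf M x x \<noteq> 0"
    and "bf A x x * bf M x' x' = bf M x x * bf A x' x'"
    and "bf A x x * bf M x v = bf M x x * bf A x v"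
    and "bf A x x * bf M x w = bf M x x * bf A x w"
    and "bf A x x * bf M x v' = bf M x x * bf A x v' \<Longrightarrow> d * a = b * c"
proof -
  note commA = bf_commute[OF sym(1)] and commM = bf_commute[OF sym(2)]
  define T where "T = bf A t s"
  define \<alpha> where "\<alpha> = bf A s v"
  define \<beta> where "\<beta> = bf A t w"
  define m where "m = bf M v w"
  define u where "u = bf M v v'"
  have v': "v' = w + w' - v" and w': "w' = v + v' - w"
    using rel by (simp_all add: algebra_simps)
  \<comment> \<open>\<open>s\<close> is conjugate to \<open>w\<close> and \<open>w'\<close>, hence
    to \<open>w + w' = v + v'\<close>; likewise \<open>t\<close> is conjugate to
    \<open>w + w'\<close>.\<close>
  have \<alpha>': "bf A s v' = - \<alpha>" and \<beta>': "bf A t w' = - \<beta>"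
    using tangent unfolding \<alpha>_def \<beta>_def by (subst v' w', simp add: bf_bilinear)+
  have T\<alpha>: "T = (a - b) * \<alpha>"
  proof -
    have "T = bf A s (a *\<^sub>R v + b *\<^sub>R v')" unfolding T_def t[symmetric] by (rule commA)
    then show ?thesis using \<alpha>' by (simp add: bf_bilinear \<alpha>_def algebra_simps)
  qed
  have T\<beta>: "T = (c - d) * \<beta>"
  proof -
    have "T = bf A t (c *\<^sub>R w + d *\<^sub>R w')" unfolding T_def s[symmetric] by simp
    then show ?thesis using \<beta>' by (simp add: bf_bilinear \<beta>_def algebra_simps)
  qed
  have m': "bf M v' w' = m"
  proof -
    have e: "v - w = w' - v'" using rel by (simp add: algebra_simps)
    have "bf M (v - w) (v - w) = bf M (w' - v') (w' - v')" unfolding e ..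
    then show ?thesis
      using null commM[of w v] commM[of w' v'] by (simp add: bf_bilinear m_def)
  qed
  have uw: "bf M w v' = u - m"
  proof -
    have "bf M v' w' = bf M v' (v + v' - w)" using w' by simp
    then show ?thesis
      using null m' commM[of w v'] commM[of v v'] by (simp add: bf_bilinear u_def)
  qed
  have xvw: "x = (d * (a - b)) *\<^sub>R v + (b * (d - c)) *\<^sub>R w"
    unfolding x t s v' by (simp add: algebra_simps)
  have xvw': "x' = (c * (b - a)) *\<^sub>R v' + (a * (c - d)) *\<^sub>R w'"
  proof -
    have v: "v = w + w' - v'" using rel by (simp add: algebra_simps)
    show ?thesis unfolding x' t s v by (simp add: algebra_simps)
  qed
  have Axx: "bf A x x = - 2 * b * d * T" and Axx': "bf A x' x' = - 2 * a * c * T"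
    using tangent commA[of s t] unfolding x x' T_def by (simp_all add: bf_bilinear)
  have Mxx: "bf M x x = 2 * d * (a - b) * b * (d - c) * m"
    using null commM[of w v] unfolding xvw m_def by (simp add: bf_bilinear)
  have Mxx': "bf M x' x' = 2 * c * (b - a) * a * (c - d) * m"
    using null commM[of w' v'] m' unfolding xvw' by (simp add: bf_bilinear)
  have Axv: "bf A x v = - b * \<alpha>" "bf A x w = d * \<beta>" "bf A x v' = b * \<alpha>"
    using tangent \<alpha>' unfolding x \<alpha>_def \<beta>_def by (simp_all add: bf_bilinear)
  have Mxv: "bf M x v = b * (d - c) * m" "bf M x w = d * (a - b) * m"
    "bf M x v' = d * (a - b) * u + b * (d - c) * (u - m)"
    using null uw commM[of w v] unfolding xvw m_def u_def by (simp_all add: bf_bilinear)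
  have T0: "T \<noteq> 0" and m0: "m \<noteq> 0" and u0: "u \<noteq> 0"
    using nonzero by (simp_all add: T_def m_def u_def)
  have ab: "a - b \<noteq> 0" and cd: "d - c \<noteq> 0"
    using T0 T\<alpha> T\<beta> by auto
  show "bf A x x \<noteq> 0" using nonzero T0 by (simp add: Axx)
  show "bf M x x \<noteq> 0" using nonzero m0 ab cd by (simp add: Mxx)
  show "bf A x x * bf M x' x' = bf M x x * bf A x' x'"
    unfolding Axx Mxx Axx' Mxx' by (simp add: algebra_simps)
  show "bf A x x * bf M x v = bf M x x * bf A x v"
    unfolding Axx Mxx Axv Mxv T\<alpha> by (simp add: algebra_simps)
  show "bf A x x * bf M x w = bf M x x * bf A x w"
    unfolding Axx Mxx Axv Mxv T\<beta> by (simp add: algebra_simps)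
  assume "bf A x x * bf M x v' = bf M x x * bf A x v'"
  \<comment> \<open>The defect factors completely. Since \<open>t\<close> and \<open>s\<close> are
    independent, the last factor vanishes exactly when \<open>x\<close> and \<open>x'\<close> are
    proportional.\<close>
  moreover have "bf A x x * bf M x v' - bf M x x * bf A x v' = - 2 * b * d * T * u * (d * a - b * c)"
    unfolding Axx Mxx Axv Mxv T\<alpha> by (simp add: algebra_simps)
  ultimately show "d * a = b * c"
    using nonzero T0 u0 by simp
qed

text \<open>All conclusions are homogeneous, so rescaling reduces them to
  \<open>pencil_step_normalized\<close>. Here \<open>v v'\<close> and \<open>w w'\<close> are two
  sides touching the conic of \<open>A\<close> at \<open>t\<close> and \<open>s\<close>, and the
  chord \<open>t s\<close> meets the diagonals \<open>v w\<close> and \<open>v' w'\<close> at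
  \<open>x\<close> and \<open>x'\<close>.\<close>

lemma pencil_step:
  assumes A: "transpose A = A" "det A \<noteq> 0" and M: "transpose M = M" "det M \<noteq> 0"
    and null: "bf M v v = 0" "bf M v' v' = 0" "bf M w w = 0" "bf M w' w' = 0"
    and indep: "v \<times> v' \<noteq> 0" "v \<times> w \<noteq> 0" "v \<times> w' \<noteq> 0" "v' \<times> w \<noteq> 0" "v' \<times> w' \<noteq> 0" "w \<times> w' \<noteq> 0"
    and off: "bf A v v \<noteq> 0" "bf A v' v' \<noteq> 0" "bf A w w \<noteq> 0" "bf A w' w' \<noteq> 0"
    and side: "(v \<times> v') \<bullet> t = 0" "(w \<times> w') \<bullet> s = 0" and ts: "t \<times> s \<noteq> 0"
    and tangent: "bf A t t = 0" "bf A s s = 0" "bf A t v = 0" "bf A t v' = 0" "bf A s w = 0" "bf A s w' = 0"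
    and x: "x \<noteq> 0" "(t \<times> s) \<bullet> x = 0" "(v \<times> w) \<bullet> x = 0"
    and x': "x' \<noteq> 0" "(t \<times> s) \<bullet> x' = 0" "(v' \<times> w') \<bullet> x' = 0"
  shows "bf A x x \<noteq> 0" "bf M x x \<noteq> 0"
    and "bf A x x * bf M x' x' = bf M x x * bf A x' x'"
    and "bf A x x * bf M x v = bf M x x * bf A x v"
    and "bf A x x * bf M x w = bf M x x * bf A x w"
    and "bf A x x * bf M x v' = bf M x x * bf A x v' \<Longrightarrow> x \<times> x' = 0"
proof -
  note ind = null_vectors_independent[OF M]
  have d0: "(v \<times> v') \<bullet> w \<noteq> 0" "(v \<times> v') \<bullet> w' \<noteq> 0" "(v \<times> w) \<bullet> w' \<noteq> 0" "(v' \<times> w) \<bullet> w' \<noteq> 0"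
    using null indep by (simp_all add: ind)
  \<comment> \<open>The sign of \<open>e3\<close> is chosen so that absorbing the coefficients into
    the vectors gives \<open>V + V' = W + w'\<close>.\<close>
  obtain e1 e2 e3 where w': "w' = e1 *\<^sub>R v + e2 *\<^sub>R v' - e3 *\<^sub>R w"
  proof -
    let ?D = "(v \<times> v') \<bullet> w"
    have "?D *\<^sub>R w' = ((w' \<times> v') \<bullet> w) *\<^sub>R v + ((v \<times> w') \<bullet> w) *\<^sub>R v' + ((v \<times> v') \<bullet> w') *\<^sub>R w"
      using cross3_cramer[of w' v' w v] by simp
    then have "w' = inverse ?D *\<^sub>R (((w' \<times> v') \<bullet> w) *\<^sub>R v + ((v \<times> w') \<bullet> w) *\<^sub>R v' + ((v \<times> v') \<bullet> w') *\<^sub>R w)"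
      using d0(1) by (metis left_inverse scaleR_one scaleR_scaleR)
    then have "w' = (inverse ?D * ((w' \<times> v') \<bullet> w)) *\<^sub>R v + (inverse ?D * ((v \<times> w') \<bullet> w)) *\<^sub>R v'
        - (- inverse ?D * ((v \<times> v') \<bullet> w')) *\<^sub>R w"
      by (simp add: scaleR_add_right)
    then show thesis by (rule that)
  qed
  have e0: "e1 \<noteq> 0" "e2 \<noteq> 0" "e3 \<noteq> 0"
    using d0 unfolding w' by (auto simp: inner_simps dot_cross_self)
  define V where "V = e1 *\<^sub>R v"
  define V' where "V' = e2 *\<^sub>R v'"
  define W where "W = e3 *\<^sub>R w"
  note defs = V_def V'_def W_def
  have rel: "V + V' = W + w'"
    by (simp add: w' defs)
  have VV': "V \<times> V' \<noteq> 0" "W \<times> w' \<noteq> 0" "(V \<times> V') \<bullet> t = 0" "(W \<times> w') \<bullet> s = 0"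
    using indep side e0 by (simp_all add: defs cross_mult_left cross_mult_right)
  obtain a b where t: "t = a *\<^sub>R V + b *\<^sub>R V'"
    using VV' span_two_if_coplanar by metis
  obtain c d where s: "s = c *\<^sub>R W + d *\<^sub>R w'"
    using VV' span_two_if_coplanar by metis
  have ts0: "t \<noteq> 0" "s \<noteq> 0"
    using ts by auto
  \<comment> \<open>If one of these vanished, a point of tangency would be a vertex, and that vertex
    would lie on the conic of \<open>A\<close>, against \<open>off\<close>.\<close>
  have abcd: "a \<noteq> 0" "b \<noteq> 0" "c \<noteq> 0" "d \<noteq> 0"
    using ts0 tangent off e0 unfolding t s defs by (auto simp: bf_bilinear)
  have A0: "bf A t s \<noteq> 0"
    using null_vectors_not_conjugate[OF A ts] tangent by simp
  have M0: "bf M V W \<noteq> 0" "bf M V V' \<noteq> 0"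
    using null_vectors_not_conjugate[OF M] null indep e0 by (simp_all add: defs bf_bilinear)
  have W'0: "(V \<times> W) \<bullet> w' \<noteq> 0" "(V' \<times> w') \<bullet> V \<noteq> 0"
  proof -
    show "(V \<times> W) \<bullet> w' \<noteq> 0"
      using d0 e0 by (simp add: defs cross_mult_left cross_mult_right)
    show "(V' \<times> w') \<bullet> V \<noteq> 0"
      using d0(2) e0 cross_triple[of v v' w'] by (simp add: defs cross_mult_left cross_mult_right)
  qed
  \<comment> \<open>After eliminating \<open>V'\<close>, only the \<open>w'\<close>-component of
    \<open>x\<close> survives the product with \<open>V \<times> W\<close>; its vanishing fixes the
    ratio of \<open>p\<close> and \<open>q\<close>.\<close>
  obtain k where k: "x = k *\<^sub>R (d *\<^sub>R t - b *\<^sub>R s)"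
  proof -
    obtain p q where pq: "x = p *\<^sub>R t + q *\<^sub>R s"
      using ts x span_two_if_coplanar by metis
    have V': "V' = W + w' - V" using rel by (simp add: algebra_simps)
    have "0 = (V \<times> W) \<bullet> x"
      using x by (simp add: defs cross_mult_left cross_mult_right)
    also have "\<dots> = (p * b + q * d) * ((V \<times> W) \<bullet> w')"
      unfolding pq t s V' by (simp add: inner_simps dot_cross_self algebra_simps)
    finally have "p * b + q * d = 0" using W'0 by simp
    then have "q = - (p / d) * b" using abcd by (simp add: field_simps)
    then have "x = (p / d) *\<^sub>R (d *\<^sub>R t - b *\<^sub>R s)"
      using abcd unfolding pq by (simp add: scaleR_diff_right)
    then show thesis by (rule that)
  qed
  obtain l where l: "x' = l *\<^sub>R (c *\<^sub>R t - a *\<^sub>R s)"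
  proof -
    obtain p q where pq: "x' = p *\<^sub>R t + q *\<^sub>R s"
      using ts x' span_two_if_coplanar by metis
    have W: "W = V + V' - w'" using rel by (simp add: algebra_simps)
    have "0 = (V' \<times> w') \<bullet> x'"
      using x' by (simp add: defs cross_mult_left cross_mult_right)
    also have "\<dots> = (p * a + q * c) * ((V' \<times> w') \<bullet> V)"
      unfolding pq t s W by (simp add: inner_simps dot_cross_self algebra_simps)
    finally have "p * a + q * c = 0" using W'0 by simp
    then have "q = - (p / c) * a" using abcd by (simp add: field_simps)
    then have "x' = (p / c) *\<^sub>R (c *\<^sub>R t - a *\<^sub>R s)"
      using abcd unfolding pq by (simp add: scaleR_diff_right)
    then show thesis by (rule that)
  qed
  have kl: "k \<noteq> 0" "l \<noteq> 0"
    using x x' k l by auto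
  have N: "bf M V V = 0" "bf M V' V' = 0" "bf M W W = 0" "bf A t V = 0" "bf A t V' = 0" "bf A s W = 0"
    using null tangent by (simp_all add: defs bf_bilinear)
  note step = pencil_step_normalized[OF A(1) M(1) N(1-3) null(4) rel t s tangent(1,2) N(4-6) tangent(6) A0 M0 abcd(2,4) refl refl]
  show "bf A x x \<noteq> 0" "bf M x x \<noteq> 0"
    using step(1,2) kl unfolding k by (simp_all only: bf_bilinear) auto
  show "bf A x x * bf M x' x' = bf M x x * bf A x' x'"
    using step(3) unfolding k l by (simp only: bf_bilinear(5,6)) (simp add: mult_ac)
  show "bf A x x * bf M x v = bf M x x * bf A x v"
    using step(4) e0 unfolding k V_def by (simp only: bf_bilinear(5,6)) (simp add: mult_ac)
  show "bf A x x * bf M x w = bf M x x * bf A x w"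
    using step(5) e0 unfolding k W_def by (simp only: bf_bilinear(5,6)) (simp add: mult_ac)
  assume "bf A x x * bf M x v' = bf M x x * bf A x v'"
  then have "d * a = b * c"
    using kl e0 by (intro step(6)) (simp only: bf_bilinear(5,6) k V'_def, simp add: mult_ac)
  then have "c *\<^sub>R (d *\<^sub>R t - b *\<^sub>R s) = d *\<^sub>R (c *\<^sub>R t - a *\<^sub>R s)"
    by (simp add: scaleR_diff_right mult_ac)
  then have "(c *\<^sub>R (d *\<^sub>R t - b *\<^sub>R s)) \<times> (c *\<^sub>R t - a *\<^sub>R s) = 0"
    by (simp add: cross_mult_left)
  then show "x \<times> x' = 0"
    using abcd unfolding k l by (simp add: cross_mult_left cross_mult_right)
qed

subsection \<open>Lines and conics in the projective plane\<close>

lemma rep_ppoint_nonzero: "rep_ppoint X \<noteq> 0"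
  using Quotient3_rep_reflp[OF Quotient3_ppoint, of X] by (simp add: proportional_def)

lemma abs_rep_ppoint: "abs_ppoint (rep_ppoint X) = X"
  by (rule Quotient3_abs_rep[OF Quotient3_ppoint])

lemma ppoint_cases:
  obtains x where "x \<noteq> 0" "X = abs_ppoint x"
  using rep_ppoint_nonzero abs_rep_ppoint by metis

lemma proportional_refl: "proportional x x \<longleftrightarrow> x \<noteq> 0"
  unfolding proportional_def by (metis scaleR_one)

lemma proportional_iff_cross3:
  assumes "x \<noteq> 0" "y \<noteq> 0"
  shows "proportional x y \<longleftrightarrow> x \<times> y = 0"
  using assms parallel_if_cross3_zero[of x y] unfolding proportional_def
  by (metis cross_mult_right cross_refl scaleR_zero_right)

lemma abs_ppoint_eq_iff:
  assumes "x \<noteq> 0" "y \<noteq> 0"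
  shows "abs_ppoint x = abs_ppoint y \<longleftrightarrow> x \<times> y = 0"
  using Quotient3_rel[OF Quotient3_ppoint, of x y] assms
  by (simp add: proportional_refl proportional_iff_cross3)

definition line :: "real^3 \<Rightarrow> ppoint set" where
  "line a = {X. incident X a}"

definition conic_of :: "real^3^3 \<Rightarrow> ppoint set" where
  "conic_of A = {X. quadric_zero A X}"

lemma mem_line: "x \<noteq> 0 \<Longrightarrow> abs_ppoint x \<in> line a \<longleftrightarrow> a \<bullet> x = 0"
  by (simp add: line_def incident.abs_eq proportional_refl)

lemma mem_conic: "x \<noteq> 0 \<Longrightarrow> abs_ppoint x \<in> conic_of A \<longleftrightarrow> bf A x x = 0"
  by (simp add: conic_of_def bf_def quadric_zero.abs_eq proportional_refl)

lemma plines_iff: "L \<in> plines \<longleftrightarrow> (\<exists>a. a \<noteq> 0 \<and> L = line a)"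
  by (simp add: plines_def line_def)

lemma conics_iff:
  "C \<in> conics \<longleftrightarrow> C \<noteq> {} \<and> (\<exists>A. transpose A = A \<and> det A \<noteq> 0 \<and> C = conic_of A)"
  by (simp add: conics_def conic_of_def)

lemma line_eq_iff:
  assumes "a \<noteq> 0" "b \<noteq> 0"
  shows "line a = line b \<longleftrightarrow> a \<times> b = 0"
proof
  assume eq: "line a = line b"
  show "a \<times> b = 0"
  proof (rule ccontr)
    assume ab: "a \<times> b \<noteq> 0"
    \<comment> \<open>A point of the first line that is off the second, since
      \<open>?x \<bullet> b\<close> is minus the squared norm of
      \<open>a \<times> b\<close>.\<close>
    let ?x = "a \<times> (a \<times> b)"
    have xb: "b \<bullet> ?x \<noteq> 0"
    proof -
      have "?x \<bullet> b = (a \<times> b) \<times> b \<bullet> a" by (rule cross_triple)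
      also have "\<dots> = (b \<times> a) \<bullet> (a \<times> b)" by (rule cross_triple)
      also have "\<dots> = - ((a \<times> b) \<bullet> (a \<times> b))" by (subst cross_skew) simp
      finally show ?thesis using ab by (simp add: inner_commute)
    qed
    then have "?x \<noteq> 0" by auto
    then show False
      using eq xb mem_line dot_cross_self(1) by metis
  qed
next
  assume "a \<times> b = 0"
  then obtain c where "b = c *\<^sub>R a"
    using assms(1) parallel_if_cross3_zero by metis
  then have "a \<bullet> x = 0 \<longleftrightarrow> b \<bullet> x = 0" for x
    using assms by simp
  then show "line a = line b"
    by (metis mem_line ppoint_cases set_eq_iff)
qed

lemma join_abs_ppoint:
  assumes "x \<times> y \<noteq> 0"
  shows "join (abs_ppoint x) (abs_ppoint y) = line (x \<times> y)"
proof -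
  have xy: "x \<noteq> 0" "y \<noteq> 0" using assms by auto
  show ?thesis
    unfolding join_def
  proof (rule the_equality)
    show "line (x \<times> y) \<in> plines \<and> abs_ppoint x \<in> line (x \<times> y) \<and> abs_ppoint y \<in> line (x \<times> y)"
      using assms xy by (auto simp: plines_iff mem_line dot_cross_self)
  next
    fix L assume L: "L \<in> plines \<and> abs_ppoint x \<in> L \<and> abs_ppoint y \<in> L"
    then obtain a where a: "a \<noteq> 0" "L = line a" by (auto simp: plines_iff)
    then have "a \<bullet> x = 0" "a \<bullet> y = 0"
      using L xy by (auto simp: mem_line)
    then obtain c where "a = c *\<^sub>R (x \<times> y)"
      using assms parallel_cross3_if_orthogonal by metis
    then show "L = line (x \<times> y)"
      using a assms by (simp add: line_eq_iff cross_mult_left)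
  qed
qed

lemma meet_line:
  assumes "a \<times> b \<noteq> 0"
  shows "meet (line a) (line b) = abs_ppoint (a \<times> b)"
  unfolding meet_def
proof (rule the_equality)
  show "abs_ppoint (a \<times> b) \<in> line a \<and> abs_ppoint (a \<times> b) \<in> line b"
    using assms by (simp add: mem_line dot_cross_self)
next
  fix X assume X: "X \<in> line a \<and> X \<in> line b"
  obtain x where x: "x \<noteq> 0" "X = abs_ppoint x" by (rule ppoint_cases)
  then have "x \<bullet> a = 0" "x \<bullet> b = 0"
    using X by (simp_all add: mem_line inner_commute)
  then obtain c where "x = c *\<^sub>R (a \<times> b)"
    using assms parallel_cross3_if_orthogonal by metis
  then show "X = abs_ppoint (a \<times> b)"
    using x assms by (simp add: abs_ppoint_eq_iff cross_mult_left)
qed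

text \<open>The line is the polar of \<open>x\<close>, so a second common point would be a point of
  the conic conjugate to \<open>x\<close>, which \<open>null_vectors_not_conjugate\<close>
  excludes.\<close>

lemma tangent_lineI:
  assumes A: "transpose A = A" "det A \<noteq> 0" and a: "a \<noteq> 0"
    and x: "x \<noteq> 0" "bf A x x = 0" "(A *v x) \<times> a = 0"
  shows "tangent (line a) (conic_of A)" "tangency_point (line a) (conic_of A) = abs_ppoint x"
proof -
  have "A *v x \<noteq> 0"
    using x matrix_vector_mult_eq_0_iff[OF A(2)] by simp
  then obtain c where c: "a = c *\<^sub>R (A *v x)"
    using x parallel_if_cross3_zero by metis
  then have c0: "c \<noteq> 0" using a by auto
  have mem: "abs_ppoint x \<in> line a \<and> abs_ppoint x \<in> conic_of A"
    using x by (simp add: mem_line mem_conic c bf_def inner_commute)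
  have uniq: "Y = abs_ppoint x" if Y: "Y \<in> line a \<and> Y \<in> conic_of A" for Y
  proof -
    obtain y where y: "y \<noteq> 0" "Y = abs_ppoint y" by (rule ppoint_cases)
    have "bf A y x = 0" "bf A y y = 0"
      using Y y c0 by (auto simp: mem_line mem_conic c bf_def inner_commute)
    then have "y \<times> x = 0"
      using null_vectors_not_conjugate[OF A _ _ x(2), of y] by blast
    then show ?thesis using x y by (simp add: abs_ppoint_eq_iff)
  qed
  show "tangent (line a) (conic_of A)"
    using A a mem uniq unfolding tangent_def plines_iff conics_iff by blast
  show "tangency_point (line a) (conic_of A) = abs_ppoint x"
    unfolding tangency_point_def using mem uniq by (rule the_equality)
qed

text \<open>Passes from tangency as a count of common points to algebra: the line is the polar of
  its only common point \<open>x\<close>. Otherwise the quadratic form restricted to the line would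
  have a second zero.\<close>

lemma tangent_lineE:
  assumes A: "transpose A = A" and a: "a \<noteq> 0" and tan: "tangent (line a) (conic_of A)"
  obtains x where "x \<noteq> 0" "bf A x x = 0" "(A *v x) \<times> a = 0"
proof -
  obtain X where X: "X \<in> line a" "X \<in> conic_of A"
    and uniq: "\<And>Y. Y \<in> line a \<Longrightarrow> Y \<in> conic_of A \<Longrightarrow> Y = X"
    using tan unfolding tangent_def by blast
  obtain x where x: "x \<noteq> 0" "X = abs_ppoint x" by (rule ppoint_cases)
  have ax: "a \<bullet> x = 0" and xx: "bf A x x = 0"
    using X x by (simp_all add: mem_line mem_conic)
  have single: "y \<times> x = 0" if "a \<bullet> y = 0" "bf A y y = 0" "y \<noteq> 0" for y
    using uniq[of "abs_ppoint y"] that x by (simp add: mem_line mem_conic abs_ppoint_eq_iff)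
  \<comment> \<open>A second point of the line, which together with \<open>x\<close> spans
    it.\<close>
  define y where "y = a \<times> x"
  have ay: "a \<bullet> y = 0" by (simp add: y_def dot_cross_self)
  have "x \<times> y = (x \<bullet> x) *\<^sub>R a"
    using ax by (simp add: y_def Lagrange inner_commute)
  then have xy: "x \<times> y \<noteq> 0" using x a by simp
  then have yx: "y \<times> x \<noteq> 0" using cross_skew[of x y] by auto
  then have y0: "y \<noteq> 0" by auto
  have "bf A x y = 0"
  proof (rule ccontr)
    assume nz: "bf A x y \<noteq> 0"
    show False
    proof (cases "bf A y y = 0")
      case True
      then show False using single[of y] ay yx y0 by simp
    next
      case False
      \<comment> \<open>The nonzero root in \<open>r\<close> of the form at
        \<open>x + r *\<^sub>R y\<close>, which gives the second common point.\<close>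
      define r where "r = - 2 * bf A x y / bf A y y"
      define z where "z = x + r *\<^sub>R y"
      have r0: "r \<noteq> 0" using nz False by (simp add: r_def)
      have "bf A z z = r * (2 * bf A x y + r * bf A y y)"
        using xx bf_commute[OF A, of y x] by (simp add: z_def bf_bilinear algebra_simps)
      also have "\<dots> = 0" using False by (simp add: r_def)
      finally have "bf A z z = 0" .
      moreover have zx: "z \<times> x \<noteq> 0"
        using r0 yx by (simp add: z_def cross_add_left cross_mult_left)
      moreover have "a \<bullet> z = 0" using ax ay by (simp add: z_def inner_simps)
      moreover have "z \<noteq> 0" using zx by auto
      ultimately show False using single by blast
    qed
  qed
  then have "(A *v x) \<times> a = 0"
    using xy xx ax ay bf_commute[OF A, of x y]
    by (intro cross3_zero_if_orthogonal_both[of x y]) (simp_all add: bf_def inner_commute)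
  then show thesis using that x xx by blast
qed

section \<open>Uniqueness of the conic touching five lines\<close>

text \<open>By \<open>B01\<close> the form vanishes on the whole line through \<open>p 0\<close> and
  \<open>p 1\<close>. Expanding \<open>p 3\<close> and \<open>p 4\<close> in the basis
  \<open>p 0\<close>, \<open>p 1\<close>, \<open>p 2\<close> then makes \<open>p 2\<close> conjugate
  to both. So \<open>p 2\<close> is conjugate to a basis and lies in the kernel, and
  \<open>p 0\<close> and \<open>p 1\<close> follow.\<close>

lemma form_zero_if_five_common_zeros:
  assumes A: "transpose A = A" "det A \<noteq> 0" and B: "transpose B = B"
    and A0: "\<And>i. i < 5 \<Longrightarrow> bf A (p i) (p i) = 0" and B0: "\<And>i. i < 5 \<Longrightarrow> bf B (p i) (p i) = 0"
    and indep: "\<And>i j. i < j \<Longrightarrow> j < (5::nat) \<Longrightarrow> p i \<times> p j \<noteq> 0"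
    and B01: "bf B (p 0) (p 1) = 0"
  shows "B *v y = 0"
proof -
  have ind: "(p i \<times> p j) \<bullet> p l \<noteq> 0" if "i < j" "j < l" "l < 5" for i j l
    using that indep[of i j] indep[of i l] indep[of j l]
    by (intro null_vectors_independent[OF A]) (simp_all add: A0)
  have B2: "bf B (p 2) (p j) = 0" if j: "j = 3 \<or> j = 4" for j
  proof -
    let ?D = "(p 0 \<times> p 1) \<bullet> p 2" and ?d = "(p 0 \<times> p 1) \<bullet> p j"
    define \<alpha> where "\<alpha> = (p j \<times> p 1) \<bullet> p 2"
    define \<beta> where "\<beta> = (p 0 \<times> p j) \<bullet> p 2"
    define q where "q = \<alpha> *\<^sub>R p 0 + \<beta> *\<^sub>R p 1"
    have Dj: "?D *\<^sub>R p j = q + ?d *\<^sub>R p 2"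
      using cross3_cramer[of "p j" "p 1" "p 2" "p 0"] by (simp add: q_def \<alpha>_def \<beta>_def)
    have D0: "?D \<noteq> 0" "?d \<noteq> 0" using ind[of 0 1 2] ind[of 0 1 j] j by auto
    have z: "bf B (p j) (p j) = 0" "bf B (p 0) (p 0) = 0" "bf B (p 1) (p 1) = 0" "bf B (p 2) (p 2) = 0"
      using B0 j by auto
    have "bf B q q = 0"
      using z B01 bf_commute[OF B, of "p 1" "p 0"] by (simp add: q_def bf_bilinear)
    moreover have "bf B (q + ?d *\<^sub>R p 2) (q + ?d *\<^sub>R p 2) = 0"
      using z unfolding Dj[symmetric] by (simp add: bf_bilinear)
    ultimately have "?d * bf B (p 2) q = 0"
      using z bf_commute[OF B, of q "p 2"] by (auto simp: bf_bilinear)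
    then have "bf B (p 2) q = 0" using D0 by simp
    then have "bf B (p 2) (?D *\<^sub>R p j) = 0"
      unfolding Dj using z by (simp add: bf_bilinear)
    then show ?thesis using D0 by (simp add: bf_bilinear)
  qed
  have kill: "w = 0" if "w \<bullet> a = 0" "w \<bullet> b = 0" "w \<bullet> c = 0" "(a \<times> b) \<bullet> c \<noteq> 0" for w a b c :: "real^3"
    using coplanar_if_orthogonal that by blast
  have p2: "B *v p 2 = 0"
    by (rule kill[of _ "p 2" "p 3" "p 4"])
      (use B2[of 3] B2[of 4] B0[of 2] ind[of 2 3 4] bf_commute[OF B] in \<open>auto simp: bf_def inner_commute\<close>)
  then have b2: "bf B x (p 2) = 0" "bf B (p 2) x = 0" for x
    using bf_commute[OF B, of "p 2" x] by (simp_all add: bf_def)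
  have p0: "B *v p 0 = 0" and p1: "B *v p 1 = 0"
    by (rule kill[of _ "p 0" "p 1" "p 2"];
      use b2 B01 B0[of 0] B0[of 1] ind[of 0 1 2] bf_commute[OF B] in \<open>auto simp: bf_def inner_commute\<close>)+
  show ?thesis
  proof (rule kill[of _ "p 0" "p 1" "p 2"])
    show "(p 0 \<times> p 1) \<bullet> p 2 \<noteq> 0" using ind[of 0 1 2] by simp
    have "(B *v y) \<bullet> x = (B *v x) \<bullet> y" for x
      using bf_commute[OF B, of x y] by (simp add: bf_def inner_commute)
    then show "(B *v y) \<bullet> p 0 = 0" "(B *v y) \<bullet> p 1 = 0" "(B *v y) \<bullet> p 2 = 0"
      using p0 p1 p2 by simp_all
  qed
qed

lemma transpose_diff: "transpose (A - B) = transpose A - transpose (B :: real^'n^'m)"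
  by (simp add: transpose_def vec_eq_iff)

lemma bf_pencil: "bf (a *\<^sub>R M - m *\<^sub>R A) x y = a * bf M x y - m * bf A x y"
  by (simp add: bf_def matrix_vector_mult_diff_rdistrib inner_simps scaleR_matrix_vector_assoc[symmetric])

lemma transpose_pencil:
  "transpose A = A \<Longrightarrow> transpose M = M \<Longrightarrow> transpose (a *\<^sub>R M - m *\<^sub>R A) = a *\<^sub>R M - m *\<^sub>R (A :: real^'n^'n)"
  by (simp add: transpose_diff transpose_scalar)

lemma proportional_forms_if_five_common_zeros:
  assumes A: "transpose A = A" "det A \<noteq> 0" and B: "transpose B = B"
    and A0: "\<And>i. i < 5 \<Longrightarrow> bf A (p i) (p i) = 0" and B0: "\<And>i. i < 5 \<Longrightarrow> bf B (p i) (p i) = 0"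
    and indep: "\<And>i j. i < j \<Longrightarrow> j < (5::nat) \<Longrightarrow> p i \<times> p j \<noteq> 0"
  obtains k where "\<And>y. B *v y = k *\<^sub>R (A *v y)"
proof -
  let ?a = "bf A (p 0) (p 1)" and ?b = "bf B (p 0) (p 1)"
  \<comment> \<open>The combination of the two forms for which \<open>p 0\<close> and
    \<open>p 1\<close> are conjugate, the additional condition of
    \<open>form_zero_if_five_common_zeros\<close>.\<close>
  let ?C = "?a *\<^sub>R B - ?b *\<^sub>R A"
  have a0: "?a \<noteq> 0"
    using A0[of 0] A0[of 1] indep[of 0 1] by (intro null_vectors_not_conjugate[OF A]) auto
  have "?C *v y = 0" for y
    by (rule form_zero_if_five_common_zeros[OF A transpose_pencil[OF A(1) B] A0 _ indep])
      (auto simp: bf_pencil A0 B0)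
  then have "?a *\<^sub>R (B *v y) = ?b *\<^sub>R (A *v y)" for y
    by (simp add: matrix_vector_mult_diff_rdistrib scaleR_matrix_vector_assoc)
  then have "B *v y = inverse ?a *\<^sub>R (?b *\<^sub>R (A *v y))" for y
    using a0 by (metis left_inverse scaleR_one scaleR_scaleR)
  then show thesis using that[of "inverse ?a * ?b"] by simp
qed

text \<open>The inverse is the matrix of the dual conic, whose points are the tangent lines of the
  original one.\<close>

lemma symmetric_inverse:
  fixes A :: "real^'n^'n"
  assumes "transpose A = A" "det A \<noteq> 0"
  obtains B where "transpose B = B" "det B \<noteq> 0" "\<And>x. A *v (B *v x) = x" "\<And>x. B *v (A *v x) = x"
proof -
  obtain B where B: "A ** B = mat 1" "B ** A = mat 1"
    using assms(2) by (meson invertible_def invertible_det_nz)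
  have "transpose B ** A = mat 1"
    using B(1) assms(1) by (metis matrix_transpose_mul transpose_mat)
  then have "transpose B = B"
    using B by (metis matrix_mul_assoc matrix_mul_rid)
  moreover have "det B \<noteq> 0"
    using B by (metis det_I det_mul mult_zero_right zero_neq_one)
  ultimately show thesis
    using that B by (simp add: matrix_vector_mul_assoc)
qed

text \<open>By duality the five tangents are five common points of the dual conics, whose matrices
  are therefore proportional. This makes the inscribed conic unique for
  \<open>n \<ge> 5\<close>.\<close>

lemma conic_unique_if_five_common_tangents:
  assumes A: "transpose A = A" "det A \<noteq> 0" and B: "transpose B = B" "det B \<noteq> 0"
    and a: "\<And>i. i < 5 \<Longrightarrow> a i \<noteq> 0" "\<And>i j. i < j \<Longrightarrow> j < (5::nat) \<Longrightarrow> a i \<times> a j \<noteq> 0"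
    and tan: "\<And>i. i < 5 \<Longrightarrow> tangent (line (a i)) (conic_of A)" "\<And>i. i < 5 \<Longrightarrow> tangent (line (a i)) (conic_of B)"
  shows "conic_of A = conic_of B"
proof -
  have dual: "bf D (a i) (a i) = 0"
    if E: "transpose E = E" "det E \<noteq> 0" and tanE: "tangent (line (a i)) (conic_of E)"
      and D: "\<And>x. D *v (E *v x) = x" and i: "i < 5" for D E i
  proof -
    obtain x where x: "x \<noteq> 0" "bf E x x = 0" "(E *v x) \<times> a i = 0"
      using tangent_lineE[OF E(1) a(1)[OF i] tanE] by metis
    moreover have "E *v x \<noteq> 0"
      using x matrix_vector_mult_eq_0_iff[OF E(2)] by simp
    ultimately obtain c where "a i = c *\<^sub>R (E *v x)"
      using parallel_if_cross3_zero by metis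
    then show ?thesis
      using x D by (simp add: bf_def matrix_vector_mult_scaleR inner_commute)
  qed
  obtain A' where A': "transpose A' = A'" "det A' \<noteq> 0" "\<And>x. A *v (A' *v x) = x" "\<And>x. A' *v (A *v x) = x"
    using symmetric_inverse[OF A] by metis
  obtain B' where B': "transpose B' = B'" "det B' \<noteq> 0" "\<And>x. B *v (B' *v x) = x" "\<And>x. B' *v (B *v x) = x"
    using symmetric_inverse[OF B] by metis
  obtain k where k: "\<And>y. B' *v y = k *\<^sub>R (A' *v y)"
    by (rule proportional_forms_if_five_common_zeros[OF A'(1,2) B'(1), of a])
      (use dual[OF A tan(1) A'(4)] dual[OF B tan(2) B'(4)] a in auto)
  have AB: "A *v x = k *\<^sub>R (B *v x)" for x
  proof -
    have "A *v x = A *v (B' *v (B *v x))" by (simp add: B')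
    also have "\<dots> = k *\<^sub>R (B *v x)" by (simp add: k A' matrix_vector_mult_scaleR)
    finally show ?thesis .
  qed
  have "k \<noteq> 0"
  proof
    assume "k = 0"
    then have "A *v a 0 = 0" using AB by simp
    then show False using a(1)[of 0] matrix_vector_mult_eq_0_iff[OF A(2)] by simp
  qed
  then have "bf A x x = 0 \<longleftrightarrow> bf B x x = 0" for x
    using AB by (simp add: bf_def)
  then show ?thesis
    by (metis mem_conic ppoint_cases set_eq_iff)
qed

subsection \<open>The pencil of a Poncelet polygon\<close>

text \<open>In homogeneous coordinates the cross product gives both the line joining two points and
  the meet of two lines. The sides are the case \<open>l = 1\<close>, and \<open>diag_meet\<close>
  represents the vertices produced by \<open>op_D\<close>.\<close>

definition diag :: "nat \<Rightarrow> (nat \<Rightarrow> real^3) \<Rightarrow> nat \<Rightarrow> real^3" where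
  "diag l p i = p i \<times> p (i + l)"

definition diag_meet :: "nat \<Rightarrow> (nat \<Rightarrow> real^3) \<Rightarrow> nat \<Rightarrow> real^3" where
  "diag_meet l p i = diag l p i \<times> diag l p (i + 1)"

lemma not_cong_add:
  fixes i l n :: nat
  assumes "0 < l" "l < n"
  shows "\<not> [i = i + l] (mod n)"
proof
  assume "[i = i + l] (mod n)"
  then have "[i + l = i] (mod n)" by (rule cong_sym)
  then have "n dvd l" by (simp add: cong_add_lcancel_0_nat cong_0_iff)
  then show False using assms by (auto dest: dvd_imp_le)
qed

text \<open>Indices are all natural numbers, with vertices repeating with period \<open>n\<close>; thus no index ever has to be reduced.\<close>

locale conic_cycle =
  fixes n :: nat and A :: "real^3^3" and p :: "nat \<Rightarrow> real^3"
  assumes form: "transpose A = A" "det A \<noteq> 0"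
    and null: "bf A (p i) (p i) = 0"
    and indep: "\<not> [i = j] (mod n) \<Longrightarrow> p i \<times> p j \<noteq> 0"
    and periodic: "p (i + n) = p i"
begin

lemma diag_nonzero: "0 < l \<Longrightarrow> l < n \<Longrightarrow> diag l p i \<noteq> 0"
  unfolding diag_def by (intro indep not_cong_add)

lemma independent:
  "\<not> [i = j] (mod n) \<Longrightarrow> \<not> [i = l] (mod n) \<Longrightarrow> \<not> [j = l] (mod n) \<Longrightarrow> (p i \<times> p j) \<bullet> p l \<noteq> 0"
  by (rule null_vectors_independent[OF form]) (simp_all add: null indep)

text \<open>If two diagonals were the same line, it would carry all four of their endpoints, but a
  line has at most two points of the conic. So \<open>j\<close> would be congruent to
  \<open>i + l\<close> and \<open>i\<close> to \<open>j + l\<close>, making \<open>2 * l\<close>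
  divisible by \<open>n\<close>.\<close>

lemma diag_distinct:
  assumes l: "0 < l" "2 * l < n" and ij: "\<not> [i = j] (mod n)"
  shows "diag l p i \<times> diag l p j \<noteq> 0"
proof
  assume "diag l p i \<times> diag l p j = 0"
  moreover have nz: "diag l p i \<noteq> 0"
    using l by (intro diag_nonzero) auto
  ultimately obtain c where "diag l p j = c *\<^sub>R diag l p i"
    using parallel_if_cross3_zero by metis
  moreover have "diag l p j \<noteq> 0"
    using l by (intro diag_nonzero) auto
  moreover have "diag l p j \<bullet> p j = 0" "diag l p j \<bullet> p (j + l) = 0"
    by (simp_all add: diag_def dot_cross_self)
  ultimately have on: "(p i \<times> p (i + l)) \<bullet> p j = 0" "(p i \<times> p (i + l)) \<bullet> p (j + l) = 0"
    by (auto simp: diag_def)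
  have il: "\<not> [i = i + l] (mod n)"
    using l by (intro not_cong_add) auto
  have 1: "[i + l = j] (mod n)"
    using independent[OF il] on(1) ij by blast
  have 2: "[i = j + l] (mod n) \<or> [i + l = j + l] (mod n)"
    using independent[OF il] on(2) by blast
  moreover have "\<not> [i + l = j + l] (mod n)"
    using ij by (simp add: cong_add_rcancel_nat)
  moreover have "\<not> [i = j + l] (mod n)"
  proof
    assume "[i = j + l] (mod n)"
    moreover have "[j + l = i + l + l] (mod n)"
      using 1 by (simp add: cong_add_rcancel_nat cong_sym)
    ultimately have "[i = i + 2 * l] (mod n)"
      by (metis add.assoc cong_trans mult_2)
    then show False
      using not_cong_add[of "2 * l" n i] l by simp
  qed
  ultimately show False by blast
qed

end


lemma not_cong_add_left:
  fixes a b n i :: nat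
  assumes "a \<noteq> b" "a < n" "b < n"
  shows "\<not> [i + a = i + b] (mod n)"
  using assms unfolding cong_add_lcancel_nat by (simp add: cong_def)

text \<open>Coinciding points of tangency would have the same polar, so two sides would coincide,
  against \<open>diag_distinct\<close> with \<open>l = 1\<close>.\<close>

lemma (in conic_cycle) conic_cycle_tangency:
  assumes n: "2 < n" and B: "transpose B = B" "det B \<noteq> 0"
    and t: "\<And>i. t i \<noteq> 0" "\<And>i. bf B (t i) (t i) = 0" "\<And>i. t (i + n) = t i"
    and tan: "\<And>i. (B *v t i) \<times> diag 1 p i = 0"
  shows "conic_cycle n B t"
proof
  fix i j
  assume ij: "\<not> [i = j] (mod n)"
  show "t i \<times> t j \<noteq> 0"
  proof
    assume "t i \<times> t j = 0"
    then obtain c where "t j = c *\<^sub>R t i"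
      using t(1) parallel_if_cross3_zero by metis
    then have "B *v t j = c *\<^sub>R (B *v t i)" and c0: "c \<noteq> 0"
      using t(1)[of j] by (auto simp: matrix_vector_mult_scaleR)
    then have "(B *v t i) \<times> diag 1 p j = 0"
      using tan[of j] by (simp add: cross_mult_left)
    moreover have "diag 1 p i \<times> (B *v t i) = 0"
      using tan[of i] by (subst cross_skew) simp
    moreover have "B *v t i \<noteq> 0"
      using t(1) matrix_vector_mult_eq_0_iff[OF B(2)] by simp
    ultimately have "diag 1 p i \<times> diag 1 p j = 0"
      using cross3_zero_trans by metis
    then show False
      using diag_distinct[of 1 i j] n ij by simp
  qed
qed (use B t in auto)

section \<open>The Poncelet configuration and the points of tangency of the diagonals\<close>

text \<open>The assumption \<open>tangent\<close> says that side \<open>i\<close> is the polar of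
  \<open>t i\<close> with respect to \<open>A\<close>; as \<open>t i\<close> lies on that conic, the
  side touches it there.\<close>

locale poncelet_cycle = outer: conic_cycle n M v + inner: conic_cycle n A t
  for n :: nat and M A :: "real^3^3" and v t :: "nat \<Rightarrow> real^3" +
  fixes k :: nat
  assumes k: "2 \<le> k" "2 * k < n"
    and tangent: "(A *v t i) \<times> diag 1 v i = 0"
begin

abbreviation x :: "nat \<Rightarrow> real^3" where
  "x \<equiv> diag_meet k t"

lemma n: "5 \<le> n"
  using k by simp

text \<open>The side is the polar of its point of tangency, so that point is conjugate to both
  endpoints and, being on the conic, lies on the side.\<close>

lemma side_conjugate:
  "bf A (t i) (v i) = 0" "bf A (t i) (v (Suc i)) = 0" "(v i \<times> v (Suc i)) \<bullet> t i = 0"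
proof -
  have "diag 1 v i \<noteq> 0"
    using outer.diag_nonzero[of 1 i] n by simp
  moreover have "diag 1 v i \<times> (A *v t i) = 0"
    using tangent[of i] by (subst cross_skew) simp
  ultimately obtain c where c: "A *v t i = c *\<^sub>R diag 1 v i"
    using parallel_if_cross3_zero by metis
  have "t i \<noteq> 0"
    using inner.diag_nonzero[of 1 i] n by (auto simp: diag_def)
  then have "A *v t i \<noteq> 0"
    by (simp add: matrix_vector_mult_eq_0_iff[OF inner.form(2)])
  then have "c \<noteq> 0"
    using c by auto
  then show "(v i \<times> v (Suc i)) \<bullet> t i = 0"
    using inner.null[of i] c by (simp add: bf_def diag_def inner_commute)
  show "bf A (t i) (v i) = 0" "bf A (t i) (v (Suc i)) = 0"
    unfolding bf_commute[OF inner.form(1), of "t i"] by (simp_all add: bf_def c diag_def dot_cross_self)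
qed

text \<open>A vertex is conjugate to the points of tangency of both sides through it. If it were on
  the conic it would equal both of them, but they are distinct.\<close>

lemma vertex_off_inner: "bf A (v i) (v i) \<noteq> 0"
proof
  assume 0: "bf A (v i) (v i) = 0"
  have par: "v i \<times> t j = 0" if "bf A (t j) (v i) = 0" for j
  proof (rule ccontr)
    assume "v i \<times> t j \<noteq> 0"
    then have "bf A (v i) (t j) \<noteq> 0"
      using null_vectors_not_conjugate[OF inner.form] 0 inner.null by simp
    then show False
      using that bf_commute[OF inner.form(1), of "t j" "v i"] by simp
  qed
  have v0: "v i \<noteq> 0"
    using outer.diag_nonzero[of 1 i] n by (auto simp: diag_def)
  \<comment> \<open>\<open>i + n - 1\<close> serves as the cyclic predecessor of \<open>i\<close>,
    also for \<open>i = 0\<close>.\<close>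
  have "Suc (i + n - 1) = i + n"
    using n by simp
  then have "v (Suc (i + n - 1)) = v i"
    by (simp add: outer.periodic)
  then have "v i \<times> t (i + n - 1) = 0"
    using par side_conjugate(2)[of "i + n - 1"] by simp
  moreover have "t i \<times> v i = 0"
    using par[OF side_conjugate(1)] by (subst cross_skew) simp
  ultimately have "t i \<times> t (i + n - 1) = 0"
    using cross3_zero_trans[OF v0] by simp
  moreover have "\<not> [i = i + (n - 1)] (mod n)"
    using n by (intro not_cong_add) auto
  ultimately show False
    using inner.indep[of i "i + (n - 1)"] n by simp
qed

lemma x_nonzero: "x i \<noteq> 0"
  unfolding diag_meet_def using k not_cong_add[of 1 n i] by (intro inner.diag_distinct) auto

lemma x_on_chords: "(t i \<times> t (i + k)) \<bullet> x i = 0" "(t (Suc i) \<times> t (Suc i + k)) \<bullet> x i = 0"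
  by (simp_all add: diag_meet_def diag_def dot_cross_self)

lemma shifted_indep:
  "a \<noteq> b \<Longrightarrow> a < n \<Longrightarrow> b < n \<Longrightarrow> t (i + a) \<times> t (i + b) \<noteq> 0"
  "a \<noteq> b \<Longrightarrow> a < n \<Longrightarrow> b < n \<Longrightarrow> v (i + a) \<times> v (i + b) \<noteq> 0"
  by (auto intro!: inner.indep outer.indep dest: not_cong_add_left[of a b n i])

text \<open>The tangents at \<open>t i\<close> and \<open>t (Suc i)\<close> are consecutive sides
  meeting at \<open>v (Suc i)\<close>, which is thus the pole of that chord; the same holds
  \<open>k\<close> places further on. This is the source of the shift between the index of
  \<open>x\<close> and that of the diagonal.\<close>

lemma x_on_diag: "diag k v (Suc i) \<bullet> x i = 0"
  unfolding diag_def
proof (rule harmonic_point[OF inner.form])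
  show "t i \<times> t (Suc i) \<noteq> 0" "t (i + k) \<times> t (Suc (i + k)) \<noteq> 0"
    "t i \<times> t (i + k) \<noteq> 0" "t (Suc i) \<times> t (Suc (i + k)) \<noteq> 0"
    using shifted_indep(1)[of 0 1 i] shifted_indep(1)[of k "k + 1" i] shifted_indep(1)[of 0 k i]
      shifted_indep(1)[of 1 "k + 1" i] k by simp_all
  show "bf A (v (Suc i)) (t i) = 0" "bf A (v (Suc i)) (t (Suc i)) = 0"
    "bf A (v (Suc i + k)) (t (i + k)) = 0" "bf A (v (Suc i + k)) (t (Suc (i + k))) = 0"
    unfolding bf_commute[OF inner.form(1), of "v _"] by (simp_all add: side_conjugate)
qed (use x_nonzero x_on_chords inner.null in auto)

text \<open>\<open>pencil_step\<close> for the sides with indices \<open>Suc i\<close> and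
  \<open>Suc i + k\<close>: the chord joining their points of tangency contains both
  \<open>x i\<close> and \<open>x (Suc i)\<close>.\<close>

lemma x_step:
  "bf A (x i) (x i) \<noteq> 0" "bf M (x i) (x i) \<noteq> 0"
  "bf A (x i) (x i) * bf M (x (Suc i)) (x (Suc i)) = bf M (x i) (x i) * bf A (x (Suc i)) (x (Suc i))"
  "bf A (x i) (x i) * bf M (x i) (v (Suc i)) = bf M (x i) (x i) * bf A (x i) (v (Suc i))"
  "bf A (x i) (x i) * bf M (x i) (v (Suc i + k)) = bf M (x i) (x i) * bf A (x i) (v (Suc i + k))"
  "bf A (x i) (x i) * bf M (x i) (v (Suc (Suc i))) = bf M (x i) (x i) * bf A (x i) (v (Suc (Suc i))) \<Longrightarrow>
     x i \<times> x (Suc i) = 0"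
proof -
  \<comment> \<open>The bounds on \<open>k\<close> make the offsets \<open>0\<close>,
    \<open>1\<close>, \<open>k\<close> and \<open>k + 1\<close> four distinct numbers below
    \<open>n\<close>.\<close>
  have 1: "v (Suc i) \<times> v (Suc (Suc i)) \<noteq> 0" "v (Suc i) \<times> v (Suc i + k) \<noteq> 0"
    "v (Suc i) \<times> v (Suc (Suc i + k)) \<noteq> 0" "v (Suc (Suc i)) \<times> v (Suc i + k) \<noteq> 0"
    "v (Suc (Suc i)) \<times> v (Suc (Suc i + k)) \<noteq> 0" "v (Suc i + k) \<times> v (Suc (Suc i + k)) \<noteq> 0"
    using shifted_indep(2)[of 0 1 "Suc i"] shifted_indep(2)[of 0 k "Suc i"] shifted_indep(2)[of 0 "k + 1" "Suc i"]
      shifted_indep(2)[of 1 k "Suc i"] shifted_indep(2)[of 1 "k + 1" "Suc i"] shifted_indep(2)[of k "k + 1" "Suc i"] k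
    by simp_all
  have 2: "t (Suc i) \<times> t (Suc i + k) \<noteq> 0"
    using shifted_indep(1)[of 0 k "Suc i"] k by simp
  have 3: "(v (Suc i) \<times> v (Suc i + k)) \<bullet> x i = 0"
    "(v (Suc (Suc i)) \<times> v (Suc (Suc i + k))) \<bullet> x (Suc i) = 0"
    using x_on_diag[of i] x_on_diag[of "Suc i"] by (simp_all add: diag_def)
  note step = pencil_step[OF inner.form outer.form outer.null outer.null outer.null outer.null 1
      vertex_off_inner vertex_off_inner vertex_off_inner vertex_off_inner
      side_conjugate(3) side_conjugate(3) 2 inner.null inner.null
      side_conjugate(1,2) side_conjugate(1,2) x_nonzero x_on_chords(2) 3(1) x_nonzero x_on_chords(1) 3(2)]
  show "bf A (x i) (x i) \<noteq> 0" "bf M (x i) (x i) \<noteq> 0"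
    "bf A (x i) (x i) * bf M (x (Suc i)) (x (Suc i)) = bf M (x i) (x i) * bf A (x (Suc i)) (x (Suc i))"
    "bf A (x i) (x i) * bf M (x i) (v (Suc i)) = bf M (x i) (x i) * bf A (x i) (v (Suc i))"
    "bf A (x i) (x i) * bf M (x i) (v (Suc i + k)) = bf M (x i) (x i) * bf A (x i) (v (Suc i + k))"
    by (fact step(1-5))+
  show "bf A (x i) (x i) * bf M (x i) (v (Suc (Suc i))) = bf M (x i) (x i) * bf A (x i) (v (Suc (Suc i))) \<Longrightarrow>
     x i \<times> x (Suc i) = 0"
    by (fact step(6))
qed

text \<open>The member of the pencil spanned by the two conics that passes through \<open>x 0\<close>.\<close>

definition F :: "real^3^3" where
  "F = bf A (x 0) (x 0) *\<^sub>R M - bf M (x 0) (x 0) *\<^sub>R A"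

lemma transpose_F: "transpose F = F"
  unfolding F_def by (rule transpose_pencil[OF inner.form(1) outer.form(1)])

lemma bf_F: "bf F y z = bf A (x 0) (x 0) * bf M y z - bf M (x 0) (x 0) * bf A y z"
  unfolding F_def by (rule bf_pencil)

text \<open>Each step preserves the ratio of the two forms, so every \<open>x i\<close> lies on the
  same member \<open>F\<close> of the pencil.\<close>

lemma x_ratio: "bf A (x 0) (x 0) * bf M (x i) (x i) = bf M (x 0) (x 0) * bf A (x i) (x i)"
proof (induction i)
  case (Suc i)
  have "bf M (x i) (x i) * (bf A (x 0) (x 0) * bf M (x (Suc i)) (x (Suc i)))
      = (bf A (x 0) (x 0) * bf M (x i) (x i)) * bf M (x (Suc i)) (x (Suc i))" by simp
  also have "\<dots> = bf M (x 0) (x 0) * (bf A (x i) (x i) * bf M (x (Suc i)) (x (Suc i)))"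
    unfolding Suc.IH by simp
  also have "\<dots> = bf M (x i) (x i) * (bf M (x 0) (x 0) * bf A (x (Suc i)) (x (Suc i)))"
    unfolding x_step(3) by simp
  finally show ?case using x_step(2)[of i] by simp
qed simp

text \<open>By \<open>x_ratio\<close> the member of the pencil formed at \<open>x i\<close> is
  proportional to \<open>F\<close>, so the local equations of \<open>x_step\<close> become
  statements about the single form \<open>F\<close>.\<close>

lemma F_conjugate_iff:
  "bf F (x i) y = 0 \<longleftrightarrow> bf A (x i) (x i) * bf M (x i) y = bf M (x i) (x i) * bf A (x i) y"
proof -
  have "bf A (x i) (x i) * bf F (x i) y
      = bf A (x 0) (x 0) * (bf A (x i) (x i) * bf M (x i) y) - (bf M (x 0) (x 0) * bf A (x i) (x i)) * bf A (x i) y"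
    by (simp add: bf_F algebra_simps)
  also have "\<dots> = bf A (x 0) (x 0) * (bf A (x i) (x i) * bf M (x i) y - bf M (x i) (x i) * bf A (x i) y)"
    unfolding x_ratio[symmetric] by (simp add: algebra_simps)
  finally have eq: "bf A (x i) (x i) * bf F (x i) y = \<dots>" .
  have "bf F (x i) y = 0 \<longleftrightarrow> bf A (x i) (x i) * bf F (x i) y = 0"
    using x_step(1)[of i] by simp
  then show ?thesis
    unfolding eq using x_step(1)[of 0] by simp
qed

lemma F_x_null: "bf F (x i) (x i) = 0"
  by (simp add: F_conjugate_iff)

text \<open>\<open>x i\<close> is conjugate under \<open>F\<close> to both ends of the diagonal. The
  factor \<open>c\<close> may still be zero here, as \<open>F\<close> is not yet known to be
  invertible.\<close>

lemma F_x_parallel: "\<exists>c. F *v x i = c *\<^sub>R diag k v (Suc i)"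
proof -
  have "bf F (x i) (v (Suc i)) = 0" "bf F (x i) (v (Suc i + k)) = 0"
    using x_step(4,5) by (simp_all add: F_conjugate_iff)
  then have "(F *v x i) \<bullet> v (Suc i) = 0" "(F *v x i) \<bullet> v (Suc i + k) = 0"
    unfolding bf_commute[OF transpose_F, of "x i"] by (simp_all add: bf_def inner_commute)
  moreover have "diag k v (Suc i) \<noteq> 0"
    using k by (intro outer.diag_nonzero) auto
  ultimately show ?thesis
    unfolding diag_def using parallel_cross3_if_orthogonal by metis
qed

lemma F_vertex: "bf F (v i) (v i) \<noteq> 0"
  using x_step(2)[of 0] vertex_off_inner by (simp add: bf_F outer.null)

lemma x_periodic: "x (i + n * m) = x i"
proof (induction m)
  case (Suc m)
  have "t (j + n) = t j" for j by (rule inner.periodic)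
  then have "x (j + n) = x j" for j
    unfolding diag_meet_def diag_def by (metis add.assoc add.commute)
  from this[of "i + n * m"] Suc show ?case by (simp add: algebra_simps)
qed simp

section \<open>Non-degeneracy of the conic and distinctness of the new vertices\<close>

text \<open>If some \<open>x j\<close> is in the kernel of \<open>F\<close>, then
  \<open>x_step(6)\<close> makes \<open>x (Suc j)\<close> the same point, and going round the cycle
  all \<open>x i\<close> coincide in one point on all diagonals. Otherwise each diagonal is a true
  polar of some \<open>x i\<close>, and any kernel vector \<open>q\<close> lies on it.\<close>

lemma concurrent_if_degenerate:
  assumes "det F = 0"
  obtains q where "q \<noteq> 0" "F *v q = 0" "\<And>i. diag k v (Suc i) \<bullet> q = 0"
proof (cases "\<exists>i. F *v x i = 0")
  case True
  then obtain j where j: "F *v x j = 0" by blast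
  have step: "x i \<times> x (Suc i) = 0" if "F *v x i = 0" for i
  proof (rule x_step(6))
    have "bf F (x i) (v (Suc (Suc i))) = 0"
      using that unfolding bf_commute[OF transpose_F, of "x i"] by (simp add: bf_def)
    then show "bf A (x i) (x i) * bf M (x i) (v (Suc (Suc i))) = bf M (x i) (x i) * bf A (x i) (v (Suc (Suc i)))"
      by (simp add: F_conjugate_iff)
  qed
  have "\<exists>c. x (j + m) = c *\<^sub>R x j" for m
  proof (induction m)
    case 0
    show ?case by (metis add_0_right scaleR_one)
  next
    case (Suc m)
    then obtain c where c: "x (j + m) = c *\<^sub>R x j" by blast
    then have "F *v x (j + m) = 0" by (simp add: j matrix_vector_mult_scaleR)
    then obtain d where "x (Suc (j + m)) = d *\<^sub>R x (j + m)"
      using step parallel_if_cross3_zero x_nonzero by metis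
    then show ?case using c by auto
  qed
  \<comment> \<open>Adding the multiple \<open>n * j\<close> of the period also reaches indices
    below \<open>j\<close> by going forward from \<open>j\<close>.\<close>
  moreover have "x i = x (j + (i + n * j - j))" for i
  proof -
    have "j \<le> i + n * j" using n by (simp add: trans_le_add2)
    then show ?thesis using x_periodic[of i j] by simp
  qed
  ultimately have par: "\<exists>c. x i = c *\<^sub>R x j" for i by metis
  have "diag k v (Suc i) \<bullet> x j = 0" for i
  proof -
    obtain c where c: "x i = c *\<^sub>R x j" using par by blast
    then show ?thesis
      using x_on_diag[of i] x_nonzero[of i] by auto
  qed
  then show thesis using that j x_nonzero by blast
next
  case False
  obtain q where q: "q \<noteq> 0" "F *v q = 0"
    using assms by (metis invertible_det_nz invertible_left_inverse matrix_left_invertible_ker)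
  have "diag k v (Suc i) \<bullet> q = 0" for i
  proof -
    obtain c where c: "F *v x i = c *\<^sub>R diag k v (Suc i)"
      using F_x_parallel by blast
    have "c * (diag k v (Suc i) \<bullet> q) = bf F q (x i)"
      by (simp add: bf_def c inner_commute)
    also have "\<dots> = 0"
      using q unfolding bf_commute[OF transpose_F, of q] by (simp add: bf_def)
    finally show ?thesis using False c by auto
  qed
  then show thesis using that q by blast
qed

text \<open>The common point \<open>q\<close> is a zero of \<open>F\<close> while no vertex is, so
  \<open>q\<close> is not a vertex. Two diagonals sharing a vertex would then both be the line from
  it to \<open>q\<close>, putting three points of the outer conic on a line.\<close>

lemma det_F: "det F \<noteq> 0"
proof
  assume "det F = 0"
  then obtain q where q: "q \<noteq> 0" "F *v q = 0" "\<And>i. diag k v (Suc i) \<bullet> q = 0"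
    using concurrent_if_degenerate by blast
  \<comment> \<open>The diagonals \<open>?a ?b\<close> and \<open>?b ?c\<close> share
    \<open>?b\<close>. Indices start at \<open>1\<close> because concurrency is stated for
    \<open>Suc i\<close>, and \<open>2 * k < n\<close> keeps the three vertices distinct.\<close>
  let ?a = "v (1 + 0)" and ?b = "v (1 + k)" and ?c = "v (1 + 2 * k)"
  have b0: "?b \<times> q \<noteq> 0"
  proof
    assume "?b \<times> q = 0"
    then have "q \<times> ?b = 0" by (subst cross_skew) simp
    then obtain c where "?b = c *\<^sub>R q"
      using q(1) parallel_if_cross3_zero by metis
    then have "bf F ?b ?b = 0"
      using q(2) by (simp add: bf_def matrix_vector_mult_scaleR)
    then show False using F_vertex by blast
  qed
  have "(?b \<times> q) \<bullet> ?a = 0"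
    using q(3)[of 0] cross_triple[of ?a ?b q] by (simp add: diag_def)
  moreover have "(?b \<times> q) \<bullet> ?c = 0"
  proof -
    have "(?c \<times> ?b) \<bullet> q = 0"
      using q(3)[of k] cross_skew[of ?c ?b] by (simp add: diag_def mult_2)
    then show ?thesis using cross_triple[of ?c ?b q] by simp
  qed
  moreover have "(?b \<times> q) \<bullet> ?b = 0" by (simp add: dot_cross_self)
  ultimately have "(?a \<times> ?b) \<bullet> ?c = 0"
    using coplanar_if_orthogonal[OF b0] by blast
  moreover have "(?a \<times> ?b) \<bullet> ?c \<noteq> 0"
    using k by (intro outer.independent not_cong_add_left) auto
  ultimately show False by blast
qed

lemma F_tangent: "(F *v x i) \<times> diag k v (Suc i) = 0"
  using F_x_parallel[of i] by (auto simp: cross_mult_left)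

text \<open>Coinciding points would have the same polar with respect to \<open>F\<close>, so two
  \<open>k\<close>-diagonals would coincide.\<close>

lemma conic_cycle_x: "conic_cycle n F x"
proof
  fix i j assume ij: "\<not> [i = j] (mod n)"
  have fx: "F *v x i \<noteq> 0" for i
    using x_nonzero matrix_vector_mult_eq_0_iff[OF det_F] by simp
  show "x i \<times> x j \<noteq> 0"
  proof
    assume "x i \<times> x j = 0"
    then obtain e where "x j = e *\<^sub>R x i"
      using parallel_if_cross3_zero[OF x_nonzero] by metis
    then have "F *v x j = e *\<^sub>R (F *v x i)" and "e \<noteq> 0"
      using x_nonzero[of j] by (auto simp: matrix_vector_mult_scaleR)
    moreover obtain c d where "F *v x i = c *\<^sub>R diag k v (Suc i)" "F *v x j = d *\<^sub>R diag k v (Suc j)"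
      using F_x_parallel by blast
    ultimately have "d *\<^sub>R diag k v (Suc j) = (e * c) *\<^sub>R diag k v (Suc i)" "d \<noteq> 0"
      using fx by auto
    then have "diag k v (Suc j) = inverse d *\<^sub>R ((e * c) *\<^sub>R diag k v (Suc i))"
      by (metis left_inverse scaleR_one scaleR_scaleR)
    then have "diag k v (Suc i) \<times> diag k v (Suc j) = 0"
      by (simp add: cross_mult_right)
    moreover have "\<not> [Suc i = Suc j] (mod n)"
      using ij cong_add_rcancel_nat[of i 1 j n] by simp
    ultimately show False
      using outer.diag_distinct[of k "Suc i" "Suc j"] k by simp
  qed
next
  show "x (i + n) = x i" for i
    using x_periodic[of i 1] by simp
qed (use transpose_F det_F F_x_null in auto)

text \<open>If the two intersection points agreed, four diagonals would pass through one point, and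
  by polarity \<open>x i\<close>, \<open>x (Suc i)\<close>, \<open>x j\<close> and
  \<open>x (Suc j)\<close> would lie on its polar. That line meets the conic of \<open>F\<close> in
  at most two points, which forces \<open>i\<close> to be congruent to \<open>i + 2\<close>.\<close>

lemma diag_meet_Suc_distinct:
  assumes ij: "\<not> [i = j] (mod n)"
  shows "diag_meet k v (Suc i) \<times> diag_meet k v (Suc j) \<noteq> 0"
proof
  let ?w = "diag_meet k v (Suc i)"
  interpret x: conic_cycle n F x by (rule conic_cycle_x)
  have w0: "diag_meet k v l \<noteq> 0" for l
    unfolding diag_meet_def using k not_cong_add[of 1 n l] by (intro outer.diag_distinct) auto
  have self: "diag k v l \<bullet> diag_meet k v l = 0" "diag k v (Suc l) \<bullet> diag_meet k v l = 0" for l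
    by (simp_all add: diag_meet_def dot_cross_self)
  assume "?w \<times> diag_meet k v (Suc j) = 0"
  then obtain c where "diag_meet k v (Suc j) = c *\<^sub>R ?w"
    using parallel_if_cross3_zero w0 by metis
  then have "diag k v (Suc l) \<bullet> ?w = 0" if "l \<in> {i, Suc i, j, Suc j}" for l
    using that w0[of "Suc j"] self[of "Suc i"] self[of "Suc j"] by auto
  then have "(F *v ?w) \<bullet> x l = 0" if "l \<in> {i, Suc i, j, Suc j}" for l
  proof -
    obtain c where c: "F *v x l = c *\<^sub>R diag k v (Suc l)"
      using F_x_parallel by blast
    have "(F *v ?w) \<bullet> x l = bf F (x l) ?w"
      by (simp add: bf_def inner_commute)
    also have "\<dots> = bf F ?w (x l)"
      by (rule bf_commute[OF transpose_F])
    also have "\<dots> = c * (diag k v (Suc l) \<bullet> ?w)"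
      by (simp add: bf_def c inner_commute)
    also have "\<dots> = 0"
      using that \<open>\<And>l. l \<in> {i, Suc i, j, Suc j} \<Longrightarrow> diag k v (Suc l) \<bullet> ?w = 0\<close> by simp
    finally show ?thesis .
  qed
  moreover have "F *v ?w \<noteq> 0"
    using w0 matrix_vector_mult_eq_0_iff[OF det_F] by simp
  ultimately have dep: "(x i \<times> x (Suc i)) \<bullet> x l = 0" if "l \<in> {j, Suc j}" for l
    using that by (intro coplanar_if_orthogonal[of "F *v ?w"]) auto
  have "\<not> [i = Suc i] (mod n)"
    using not_cong_add[of 1 n i] n by simp
  then have *: "[i = l] (mod n) \<or> [Suc i = l] (mod n)" if "l \<in> {j, Suc j}" for l
    using x.independent[of i "Suc i" l] dep[OF that] by blast
  have ji: "[Suc i = j] (mod n)"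
    using *[of j] ij by auto
  have "\<not> [Suc i = Suc j] (mod n)"
    using ij cong_add_rcancel_nat[of i 1 j n] by simp
  then have "[i = Suc j] (mod n)"
    using *[of "Suc j"] by auto
  moreover have "[Suc j = Suc (Suc i)] (mod n)"
    using ji cong_add_rcancel_nat[of "Suc i" 1 j n] by (simp add: cong_sym_eq)
  ultimately have "[i = i + 2] (mod n)"
    using cong_trans by fastforce
  then show False
    using not_cong_add[of 2 n i] n by simp
qed

end

subsection \<open>From vectors to polygons\<close>

text \<open>Like \<open>conic_cycle\<close> but without a conic, since the vertices of
  \<open>op_D k P\<close> come with no known conic through them.\<close>

definition vector_cycle :: "nat \<Rightarrow> (nat \<Rightarrow> real^3) \<Rightarrow> bool" where
  "vector_cycle n p \<longleftrightarrow> 1 < n \<and> (\<forall>i. p (i + n) = p i) \<and> (\<forall>i j. \<not> [i = j] (mod n) \<longrightarrow> p i \<times> p j \<noteq> 0)"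

definition polygon :: "nat \<Rightarrow> (nat \<Rightarrow> real^3) \<Rightarrow> ppoint list" where
  "polygon n p = map (\<lambda>i. abs_ppoint (p i)) [0..<n]"

lemma periodic_mod:
  fixes f :: "nat \<Rightarrow> 'a"
  assumes "\<And>i. f (i + n) = f i"
  shows "f (i mod n) = f i"
proof -
  have "f (j + m * n) = f j" for j m
    by (induction m) (simp_all add: add.assoc[symmetric] assms add.commute[of n])
  then show ?thesis
    by (metis mod_mult_div_eq mult.commute)
qed

lemma diag_periodic: "(\<And>i. p (i + n) = p i) \<Longrightarrow> diag l p (i + n) = diag l p i"
  unfolding diag_def by (metis add.assoc add.commute)

lemma diag_meet_periodic: "(\<And>i. p (i + n) = p i) \<Longrightarrow> diag_meet l p (i + n) = diag_meet l p i"
  unfolding diag_meet_def using diag_periodic[of p n l] by (metis add.assoc add.commute)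

lemma (in conic_cycle) vector_cycle: "1 < n \<Longrightarrow> vector_cycle n p"
  by (simp add: vector_cycle_def periodic indep)

context
  fixes n p assumes cyc: "vector_cycle n p"
begin

lemma cycle_side_nonzero: "diag 1 p i \<noteq> 0"
  using cyc not_cong_add[of 1 n i] by (simp add: vector_cycle_def diag_def)

lemma cycle_nonzero: "p i \<noteq> 0"
  using cycle_side_nonzero[of i] by (auto simp: diag_def)

lemma vertex_polygon: "vertex (polygon n p) i = abs_ppoint (p i)"
proof -
  have "p (i mod n) = p i"
    using cyc by (intro periodic_mod) (simp add: vector_cycle_def)
  then show ?thesis
    using cyc by (simp add: vertex_def polygon_def vector_cycle_def)
qed

lemma is_ngon_polygon: "is_ngon n (polygon n p)"
proof -
  have "inj_on (\<lambda>i. abs_ppoint (p i)) {0..<n}"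
  proof (rule inj_onI)
    fix i j assume ij: "i \<in> {0..<n}" "j \<in> {0..<n}" "abs_ppoint (p i) = abs_ppoint (p j)"
    then have "p i \<times> p j = 0"
      by (simp add: abs_ppoint_eq_iff cycle_nonzero)
    then have "[i = j] (mod n)"
      using cyc by (auto simp: vector_cycle_def)
    then show "i = j"
      using ij by (simp add: cong_def)
  qed
  then show ?thesis
    by (simp add: is_ngon_def polygon_def distinct_map)
qed

lemma diagonal_polygon:
  assumes "diag l p i \<noteq> 0"
  shows "diagonal l (polygon n p) i = line (diag l p i)"
  using assms by (simp add: diagonal_def vertex_polygon join_abs_ppoint diag_def)

lemma op_D_polygon:
  assumes "\<And>i. diag k p i \<noteq> 0" "\<And>i. diag k p i \<times> diag k p (i + 1) \<noteq> 0"
  shows "op_D k (polygon n p) = polygon n (diag_meet k p)"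
  using assms by (simp add: op_D_def polygon_def[of n "diag_meet k p"] diagonal_polygon meet_line diag_meet_def)
    (simp add: polygon_def)

lemma D_defined_polygon:
  assumes "\<And>i. diag k p i \<noteq> 0" "\<And>i. diag k p i \<times> diag k p (i + 1) \<noteq> 0"
    and "is_ngon n (polygon n (diag_meet k p))"
  shows "D_defined n k (polygon n p)"
  unfolding D_defined_def
proof (intro conjI allI impI)
  fix i
  show "vertex (polygon n p) i \<noteq> vertex (polygon n p) (i + k)"
    using assms(1)[of i] by (simp add: vertex_polygon abs_ppoint_eq_iff cycle_nonzero diag_def)
  show "diagonal k (polygon n p) i \<noteq> diagonal k (polygon n p) (i + 1)"
    using assms(1,2) by (simp add: diagonal_polygon line_eq_iff)
  show "is_ngon n (polygon n p)" by (rule is_ngon_polygon)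
  show "is_ngon n (op_D k (polygon n p))"
    using assms by (simp add: op_D_polygon)
qed

end

text \<open>Computes \<open>op_I\<close> from algebraic data: a form \<open>E\<close> and points
  \<open>x i\<close> on its conic whose polars are the sides. It serves for both \<open>P\<close>
  and \<open>op_D k P\<close>; uniqueness of the inscribed conic comes from the first five
  sides.\<close>

lemma circumscribed_sides:
  assumes n: "5 \<le> n" and Q: "is_ngon n Q" "\<And>i. i < n \<Longrightarrow> side Q i = line (a i)"
    and a: "\<And>i. a i \<noteq> 0" "\<And>i j. \<not> [i = j] (mod n) \<Longrightarrow> a i \<times> a j \<noteq> 0"
    and E: "transpose E = E" "det E \<noteq> 0"
    and x: "vector_cycle n x" "\<And>i. bf E (x i) (x i) = 0" "\<And>i. (E *v x i) \<times> a i = 0"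
  shows "I_defined n Q" "op_I Q = polygon n x"
proof -
  have len: "length Q = n" using Q(1) by (simp add: is_ngon_def)
  note x0 = cycle_nonzero[OF x(1)]
  note tangent = tangent_lineI[OF E a(1) x0 x(2,3)]
  have "conic_of E \<in> conics"
    using tangent(1)[of 0] by (simp add: tangent_def)
  then have circ: "circumscribed_about Q (conic_of E)"
    using tangent(1) Q(2) by (simp add: circumscribed_about_def len)
  have uniq: "C = conic_of E" if C: "circumscribed_about Q C" for C
  proof -
    obtain B where B: "transpose B = B" "det B \<noteq> 0" "C = conic_of B"
      using C by (auto simp: circumscribed_about_def conics_iff)
    have "conic_of E = conic_of B"
    proof (rule conic_unique_if_five_common_tangents[OF E B(1,2) a(1)])
      fix i :: nat assume "i < 5"
      then have "i < n" using n by simp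
      then have "tangent (side Q i) (conic_of B)"
        using C by (simp add: circumscribed_about_def B(3) len)
      then show "tangent (line (a i)) (conic_of B)"
        using Q(2) \<open>i < n\<close> by simp
    next
      fix i j :: nat assume "i < j" "j < 5"
      then show "a i \<times> a j \<noteq> 0" using n by (intro a(2)) (simp add: cong_def)
    qed (rule tangent(1))
    then show ?thesis using B by simp
  qed
  have "inscribed_conic Q = conic_of E"
    unfolding inscribed_conic_def using circ uniq by (rule the_equality)
  then show op: "op_I Q = polygon n x"
    unfolding op_I_def polygon_def len using Q(2) tangent(2) by simp
  show "I_defined n Q"
    unfolding I_defined_def op using Q(1) circ uniq is_ngon_polygon[OF x(1)] by blast
qed

theorem theorem2:
  fixes n k :: nat and P :: "ppoint list"
  assumes "n \<ge> 5" and "2 \<le> k" and "2 * k < n"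
    and "poncelet_ngon n P"
  shows "D_defined n k P \<and> I_defined n (op_D k P) \<and>
         I_defined n P \<and> D_defined n k (op_I P) \<and>
         same_polygon (op_I (op_D k P)) (op_D k (op_I P))"
proof -
  have len: "length P = n" and dist: "distinct P"
    using assms(4) by (auto simp: poncelet_ngon_def is_ngon_def)
  obtain M where M: "transpose M = M" "det M \<noteq> 0" "set P \<subseteq> conic_of M"
    using assms(4) by (auto simp: poncelet_ngon_def inscribed_in_def conics_iff)
  obtain A where A: "transpose A = A" "det A \<noteq> 0" and tan: "\<And>i. i < n \<Longrightarrow> tangent (side P i) (conic_of A)"
    using assms(4) len by (auto simp: poncelet_ngon_def circumscribed_about_def conics_iff)
  define v where "v i = rep_ppoint (vertex P i)" for i
  have v0: "v i \<noteq> 0" and absv: "abs_ppoint (v i) = vertex P i" for i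
    by (simp_all add: v_def rep_ppoint_nonzero abs_rep_ppoint)
  have "P = polygon n v"
    by (rule nth_equalityI) (simp_all add: polygon_def len absv vertex_def)
  interpret outer: conic_cycle n M v
  proof
    fix i j
    have "vertex P i \<in> set P"
      using assms(1) len by (simp add: vertex_def)
    then show "bf M (v i) (v i) = 0"
      using M(3) absv[of i] mem_conic[OF v0] by (metis subsetD)
    show "v (i + n) = v i"
      by (simp add: v_def vertex_def len)
    assume "\<not> [i = j] (mod n)"
    then have "vertex P i \<noteq> vertex P j"
      using dist assms(1) len by (simp add: vertex_def nth_eq_iff_index_eq cong_def)
    then show "v i \<times> v j \<noteq> 0"
      using abs_ppoint_eq_iff[OF v0 v0] by (simp add: absv)
  qed (use M in auto)
  have vc: "vector_cycle n v"
    using assms(1) by (intro outer.vector_cycle) simp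
  have diag1: "diag 1 v i \<noteq> 0" for i
    using assms(1) by (intro outer.diag_nonzero) auto
  have side: "side P i = line (diag 1 v i)" for i
    using diagonal_polygon[OF vc diag1] \<open>P = polygon n v\<close> by (simp add: side_def diagonal_def)
  have "\<exists>t. t \<noteq> 0 \<and> bf A t t = 0 \<and> (A *v t) \<times> diag 1 v i = 0" if "i < n" for i
    using tangent_lineE[OF A(1) diag1 tan[OF that, unfolded side]] by metis
  then obtain t0 where t0: "\<And>i. i < n \<Longrightarrow> t0 i \<noteq> 0 \<and> bf A (t0 i) (t0 i) = 0 \<and> (A *v t0 i) \<times> diag 1 v i = 0"
    by metis
  \<comment> \<open>\<open>t0\<close> is constrained only below \<open>n\<close>, so its values are
    repeated with period \<open>n\<close>.\<close>
  define t where "t i = t0 (i mod n)" for i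
  have "diag 1 v (i mod n) = diag 1 v i" for i
    by (intro periodic_mod diag_periodic outer.periodic)
  then have t: "t i \<noteq> 0" "bf A (t i) (t i) = 0" "(A *v t i) \<times> diag 1 v i = 0" "t (i + n) = t i" for i
    using t0[of "i mod n"] assms(1) by (auto simp: t_def)
  have inner: "conic_cycle n A t"
    using assms(1) by (intro outer.conic_cycle_tangency A t) simp
  interpret poncelet_cycle n M A v t k
    by (intro poncelet_cycle.intro outer.conic_cycle_axioms inner poncelet_cycle_axioms.intro assms t)
  have tc: "vector_cycle n t"
    using assms(1) by (intro inner.vector_cycle) simp
  have xc: "vector_cycle n x"
    using assms(1) by (intro conic_cycle.vector_cycle[OF conic_cycle_x]) simp
  define w where "w = diag_meet k v"
  have w_periodic: "w (i + n) = w i" for i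
    unfolding w_def by (intro diag_meet_periodic outer.periodic)
  have wc: "vector_cycle n w"
    unfolding vector_cycle_def
  proof (intro conjI allI impI)
    fix i j assume ij: "\<not> [i = j] (mod n)"
    \<comment> \<open>\<open>diag_meet_Suc_distinct\<close> speaks of successors only; adding
      \<open>n - 1\<close> makes the successor of each shifted index equal to the original index
      plus one period.\<close>
    have "\<not> [i + (n - 1) = j + (n - 1)] (mod n)"
      using ij by (simp add: cong_add_rcancel_nat)
    moreover have "Suc (l + (n - 1)) = l + n" for l
      using assms(1) by simp
    ultimately show "w i \<times> w j \<noteq> 0"
      using diag_meet_Suc_distinct[of "i + (n - 1)" "j + (n - 1)"] w_periodic by (simp add: w_def)
  qed (use assms(1) w_periodic in auto)
  have diagk: "diag k v i \<noteq> 0" "diag k t i \<noteq> 0" for i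
    using assms by (intro outer.diag_nonzero inner.diag_nonzero; simp)+
  have diagk': "diag k v i \<times> diag k v (i + 1) \<noteq> 0" "diag k t i \<times> diag k t (i + 1) \<noteq> 0" for i
    using assms by (intro outer.diag_distinct inner.diag_distinct not_cong_add; simp)+
  have opD: "op_D k P = polygon n w" "op_D k (polygon n t) = polygon n x"
    unfolding \<open>P = polygon n v\<close> w_def by (intro op_D_polygon vc tc diagk diagk')+
  \<comment> \<open>Consecutive vertices \<open>w i\<close> and \<open>w (Suc i)\<close> both lie on
    the diagonal \<open>Suc i\<close>, the one that \<open>F\<close> touches at
    \<open>x i\<close>.\<close>
  have side_w: "side (polygon n w) i = line (diag k v (Suc i))" for i
  proof -
    have ww: "diag 1 w i \<noteq> 0"
      by (rule cycle_side_nonzero[OF wc])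
    have "side (polygon n w) i = line (diag 1 w i)"
      using diagonal_polygon[OF wc ww] by (simp add: side_def diagonal_def)
    also have "\<dots> = line (diag k v (Suc i))"
    proof -
      have "diag k v (Suc i) \<bullet> w i = 0" "diag k v (Suc i) \<bullet> w (Suc i) = 0"
        by (simp_all add: w_def diag_meet_def dot_cross_self)
      then obtain c where "diag k v (Suc i) = c *\<^sub>R diag 1 w i"
        using ww parallel_cross3_if_orthogonal[of "w i" "w (Suc i)"] by (auto simp: diag_def)
      moreover from this have "c \<noteq> 0"
        using diagk(1)[of "Suc i"] by auto
      ultimately show ?thesis
        using ww by (simp add: line_eq_iff cross_mult_right)
    qed
    finally show ?thesis .
  qed
  have IP: "I_defined n P" "op_I P = polygon n t"
    using circumscribed_sides[OF assms(1) _ side diag1 outer.diag_distinct A tc t(2,3)]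
      is_ngon_polygon[OF vc] \<open>P = polygon n v\<close> assms(1) by auto
  have IDP: "I_defined n (polygon n w)" "op_I (polygon n w) = polygon n x"
  proof -
    have "diag k v (Suc i) \<times> diag k v (Suc j) \<noteq> 0" if "\<not> [i = j] (mod n)" for i j
      using that cong_add_rcancel_nat[of i 1 j n] assms by (intro outer.diag_distinct) auto
    note * = circumscribed_sides[OF assms(1) is_ngon_polygon[OF wc] side_w diagk(1) this
        transpose_F det_F xc F_x_null F_tangent]
    show "I_defined n (polygon n w)" "op_I (polygon n w) = polygon n x"
      using * by auto
  qed
  have "D_defined n k P"
    unfolding \<open>P = polygon n v\<close>
    using D_defined_polygon[OF vc diagk(1) diagk'(1)] is_ngon_polygon[OF wc] by (simp add: w_def)
  moreover have "D_defined n k (op_I P)"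
    unfolding IP(2) by (intro D_defined_polygon tc diagk diagk' is_ngon_polygon xc)
  \<comment> \<open>Both sides are \<open>polygon n x\<close> with the same labelling, so the
    rotation by \<open>0\<close> suffices.\<close>
  moreover have "same_polygon (op_I (op_D k P)) (op_D k (op_I P))"
    unfolding same_polygon_def opD IP(2) IDP(2) by (rule exI[of _ 0]) simp
  ultimately show ?thesis
    using IP(1) IDP(1) opD(1) by simp
qed

end
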